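(* Let $f$ be a real-valued function on $\mathbb{D}$ with the property that the weight $e^{f}$ has bounded hyperbolic oscillation. Let $\gamma(f)=\inf\{t>0: e^{f/t}\in B_2\}$. (i) One has $$2\gamma(f)\le \inf\{\|f-h\|_{\mathrm{HLip}} : h\in L^\infty(\mathbb{D})\}\le 4\gamma(f).$$ (ii) There exists a universal constant $C>0$ (independent of $f$) such that $$C^{-1}\gamma(f)\le \inf\{\|f-h\|_{BMO(\mathbb{D})} : h\in L^\infty(\mathbb{D})\}\le C\,\gamma(f).$$
   Context: $\mathbb{D}$ is the open unit disc, $\partial\mathbb{D}$ the unit circle, $m$ is Lebesgue measure on $\partial\mathbb{D}$, $dA$ is normalized Lebesgue area measure on $\mathbb{D}$. For an arc $I\subset\partial\mathbb{D}$ the associated Carleson square is $Q_I=\{z\in\mathbb{D}\setminus\{0\}: z/|z|\in I,\ 1-|z|<m(I)\}$. A weight is a positive integrable function on $\mathbb{D}$. A weight $w$ is a $B_2$-weight ($w\in B_2$) if $$[w]_{B_2}^2=\sup_I\Big(\frac1{A(Q_I)}\int_{Q_I}w\,dA\Big)\Big(\frac1{A(Q_I)}\int_{Q_I}w^{-1}\,dA\Big)<\infty,$$ the supremum being over all arcs $I\subset\partial\mathbb{D}$. The hyperbolic metric is $\beta(z,\zeta)=\frac12\log\frac{1+|\phi_z(\zeta)|}{1-|\phi_z(\zeta)|}$, where $\phi_z(\zeta)=\frac{z-\zeta}{1-\bar z\zeta}$, $z,\zeta\in\mathbb{D}$. A weight $w:\mathbb{D}\to(0,\infty)$ has bounded hyperbolic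 oscillation if there is a constant $C(w)>0$ with $|\log w(z)-\log w(\zeta)|\le C(w)(1+\beta(z,\zeta))$ for all $z,\zeta\in\mathbb{D}$. For a function $v$ on $\mathbb{D}$, $\|v\|_{\mathrm{HLip}}=\sup_{z\ne\zeta}\frac{|v(z)-v(\zeta)|}{\beta(z,\zeta)}$ (possibly $+\infty$). $L^\infty(\mathbb{D})$ is the space of essentially bounded real-valued functions on $\mathbb{D}$. For integrable real-valued $f$ on $\mathbb{D}$, $\|f\|_{BMO(\mathbb{D})}=\sup\frac1{A(D\cap\mathbb{D})}\int_{D\cap\mathbb{D}}|f-f_{D\cap\mathbb{D}}|\,dA$, the supremum being over all discs $D$ centered at points of $\mathbb{D}$, where $f_{D\cap\mathbb{D}}$ is the mean of $f$ over $D\cap\mathbb{D}$ with respect to $dA$; $f\in BMO(\mathbb{D})$ if this is finite. (If $e^f$ has bounded hyperbolic oscillation then $f\in BMO(\mathbb{D})$.) *)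

theory Defs
  imports "HOL-Analysis.Analysis"
begin

text \<open>Functions on the unit disc are total functions on \<^typ>\<open>complex\<close> whose values outside
  the disc are never used.  Suprema, infima and norms that may be infinite are taken in
  \<^typ>\<open>ennreal\<close>.\<close>

abbreviation unit_disc :: "complex set" where
  "unit_disc \<equiv> ball 0 1"

definition disc_area :: "complex measure" where
  "disc_area = scale_measure (ennreal (1 / pi)) (lebesgue_on unit_disc)"

text \<open>Arc length on the unit circle, with total mass $2\pi$.  Replacing it by the probability
  measure changes the shape of the Carleson squares but not the class of $B_2$-weights.\<close>

definition circle_measure :: "complex measure" where
  "circle_measure = distr (restrict_space lborel {-pi<..pi}) borel cis"

text \<open>All nondegenerate arcs, open, closed or half-open, including the whole circle (intervals
  longer than $2\pi$ are harmless).\<close>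

definition arcs :: "complex set set" where
  "arcs = {cis ` J | J. is_interval J \<and> interior J \<noteq> {}}"

definition carleson_square :: "complex set \<Rightarrow> complex set" where
  "carleson_square I =
     {z \<in> unit_disc - {0}. z / of_real (norm z) \<in> I \<and> 1 - norm z < measure circle_measure I}"

definition weight :: "(complex \<Rightarrow> real) \<Rightarrow> bool" where
  "weight w \<longleftrightarrow> (\<forall>z\<in>unit_disc. 0 < w z) \<and> integrable disc_area w"

text \<open>The square of the $B_2$-characteristic.\<close>

definition B2_const_sq :: "(complex \<Rightarrow> real) \<Rightarrow> ennreal" where
  "B2_const_sq w = (SUP I\<in>arcs.
     (1 / emeasure disc_area (carleson_square I) *
        (\<integral>\<^sup>+z\<in>carleson_square I. ennreal (w z) \<partial>disc_area)) *
     (1 / emeasure disc_area (carleson_square I) *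
        (\<integral>\<^sup>+z\<in>carleson_square I. ennreal (inverse (w z)) \<partial>disc_area)))"

definition B2_weight :: "(complex \<Rightarrow> real) \<Rightarrow> bool" where
  "B2_weight w \<longleftrightarrow> weight w \<and> B2_const_sq w < \<infinity>"

definition disc_phi :: "complex \<Rightarrow> complex \<Rightarrow> complex" where
  "disc_phi z \<zeta> = (z - \<zeta>) / (1 - cnj z * \<zeta>)"

definition hyp_dist :: "complex \<Rightarrow> complex \<Rightarrow> real" where
  "hyp_dist z \<zeta> = 1 / 2 * ln ((1 + norm (disc_phi z \<zeta>)) / (1 - norm (disc_phi z \<zeta>)))"

definition bounded_hyp_oscillation :: "(complex \<Rightarrow> real) \<Rightarrow> bool" where
  "bounded_hyp_oscillation w \<longleftrightarrow> weight w \<and>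
     (\<exists>C>0. \<forall>z\<in>unit_disc. \<forall>\<zeta>\<in>unit_disc.
        \<bar>ln (w z) - ln (w \<zeta>)\<bar> \<le> C * (1 + hyp_dist z \<zeta>))"

definition HLip_norm :: "(complex \<Rightarrow> real) \<Rightarrow> ennreal" where
  "HLip_norm v = (SUP (z, \<zeta>) \<in> {(z, \<zeta>). z \<in> unit_disc \<and> \<zeta> \<in> unit_disc \<and> z \<noteq> \<zeta>}.
     ennreal (\<bar>v z - v \<zeta>\<bar> / hyp_dist z \<zeta>))"

text \<open>Representatives of the elements of $L^\infty$: these are genuine functions, not
  identified almost everywhere.\<close>

definition Linfty_disc :: "(complex \<Rightarrow> real) set" where
  "Linfty_disc = {h \<in> borel_measurable disc_area. \<exists>C. AE z in disc_area. \<bar>h z\<bar> \<le> C}"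

definition disc_mean :: "(complex \<Rightarrow> real) \<Rightarrow> complex set \<Rightarrow> real" where
  "disc_mean f S = (LINT z:S|disc_area. f z) / measure disc_area S"

text \<open>Meaningful for integrable \<open>f\<close> only, because Bochner integrals of non-integrable functions
  are 0.\<close>

definition BMO_norm :: "(complex \<Rightarrow> real) \<Rightarrow> ennreal" where
  "BMO_norm f = (SUP (c, r) \<in> unit_disc \<times> {0<..}.
     1 / emeasure disc_area (ball c r \<inter> unit_disc) *
       (\<integral>\<^sup>+z\<in>ball c r \<inter> unit_disc.
          ennreal \<bar>f z - disc_mean f (ball c r \<inter> unit_disc)\<bar> \<partial>disc_area))"

definition gamma_B2 :: "(complex \<Rightarrow> real) \<Rightarrow> ennreal" where
  "gamma_B2 f = (INF t\<in>{t. 0 < t \<and> B2_weight (\<lambda>z. exp (f z / t))}. ennreal t)"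

end

theory Submission
  imports Defs
begin

text \<open>Up to adding a bounded function, \<open>f\<close> is \<open>L\<close>-Lipschitz for the hyperbolic metric
  \<open>\<beta>\<close> as soon as \<open>\<bar>f z - f w\<bar> \<le> L \<beta>(z, w) + C\<close>: take the inf-convolution of \<open>f\<close> and \<open>L \<beta>\<close>.
  Such an estimate with \<open>L = 4 t\<close> follows from \<open>e^(f/t) \<in> B\<^sub>2\<close>, because the two averages over a
  Carleson square of area comparable to \<open>d^2\<close>, \<open>d = \<bar>1 - cnj z * w\<bar>\<close>, dominate the contributions of
  hyperbolic balls around \<open>z\<close> and \<open>w\<close>, and \<open>d^2 / ((1 - \<bar>z\<bar>) (1 - \<bar>w\<bar>))\<close> is comparable to
  \<open>e^(2 \<beta>(z, w))\<close>.  Conversely, if \<open>f/t\<close> is within a bounded function of one with Lipschitz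
  constant \<open>\<kappa> < 2\<close>, then on a Carleson square of size \<open>l\<close> it deviates from its value at the top by
  at most \<open>(\<kappa>/2) ln (l / (1 - \<bar>z\<bar>)) + O(1)\<close>, whose exponential is integrable.

  No John--Nirenberg inequality is needed for the \<open>BMO\<close> statement.  Lipschitz functions have \<open>BMO\<close> norm
  bounded by a multiple of their Lipschitz constant; and if \<open>f - h\<close> has \<open>BMO\<close> norm \<open>N\<close>, its means over
  hyperbolic balls of fixed radius change by \<open>O(N)\<close> over unit hyperbolic distance and, as \<open>f\<close> has bounded
  hyperbolic oscillation, stay within a bounded distance of \<open>f\<close>.\<close>

section \<open>Hyperbolic geometry of the disc\<close>

lemma tanh_artanh_real:
  assumes "\<bar>x\<bar> < 1"
  shows "tanh (artanh x :: real) = x"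
proof -
  have "-2 * artanh x = ln ((1 - x) / (1 + x))"
    using assms by (simp add: artanh_def ln_div)
  then have e: "exp (-2 * artanh x) = (1 - x) / (1 + x)"
    using assms by simp
  show ?thesis
    unfolding tanh_real_altdef e using assms by (simp add: divide_simps)
qed

text \<open>The basic identity of the disc: it yields the formula for
  \<open>1 - (norm (disc_phi z w))\<^sup>2\<close>, and also |z - w| \<le> |1 - cnj z * w| for
  points of the disc.\<close>

lemma norm_one_minus_cnj_mult:
  "(norm (1 - cnj z * w))\<^sup>2 = (norm (z - w))\<^sup>2 + (1 - (norm z)\<^sup>2) * (1 - (norm w)\<^sup>2)"
  unfolding cmod_power2 by (simp add: power2_eq_square algebra_simps)

lemma norm_one_minus_cnj_mult_ge:
  assumes "norm w \<le> 1"
  shows "1 - norm z \<le> norm (1 - cnj z * w)"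
proof -
  have "norm (cnj z * w) \<le> norm z * 1"
    unfolding norm_mult using assms by (intro mult_mono) auto
  with norm_triangle_ineq2[of 1 "cnj z * w"] show ?thesis by simp
qed

lemma norm_one_minus_cnj_mult_commute: "norm (1 - cnj z * w) = norm (1 - cnj w * z)"
  using complex_mod_cnj[of "1 - cnj z * w"] by (simp add: mult.commute)

lemma norm_disc_phi: "norm (disc_phi z w) = norm (z - w) / norm (1 - cnj z * w)"
  by (simp add: disc_phi_def norm_divide)

lemma norm_disc_phi_commute: "norm (disc_phi z w) = norm (disc_phi w z)"
  by (simp add: norm_disc_phi norm_one_minus_cnj_mult_commute[of z w] norm_minus_commute)

lemma hyp_dist_commute: "hyp_dist z w = hyp_dist w z"
  by (simp add: hyp_dist_def norm_disc_phi_commute)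

context
  fixes z w :: complex
  assumes zw: "norm z < 1" "norm w < 1"
begin

lemma one_minus_cnj_mult_pos: "0 < norm (1 - cnj z * w)"
  using norm_one_minus_cnj_mult_ge[of w z] zw by linarith

lemma one_minus_norm_disc_phi_sq:
  "1 - (norm (disc_phi z w))\<^sup>2 = (1 - (norm z)\<^sup>2) * (1 - (norm w)\<^sup>2) / (norm (1 - cnj z * w))\<^sup>2"
  using one_minus_cnj_mult_pos norm_one_minus_cnj_mult[of z w]
  by (simp add: norm_disc_phi power_divide field_simps)

lemma norm_disc_phi_less_1: "norm (disc_phi z w) < 1"
proof -
  have "0 < (1 - (norm z)\<^sup>2) * (1 - (norm w)\<^sup>2) / (norm (1 - cnj z * w))\<^sup>2"
    using zw one_minus_cnj_mult_pos
    by (intro divide_pos_pos mult_pos_pos) (simp_all add: power_less_one_iff)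
  then have "(norm (disc_phi z w))\<^sup>2 < 1"
    using one_minus_norm_disc_phi_sq by linarith
  then show ?thesis by (simp add: power_less_one_iff)
qed

lemma hyp_dist_eq_artanh: "hyp_dist z w = artanh (norm (disc_phi z w))"
  using norm_disc_phi_less_1 by (simp add: hyp_dist_def artanh_def)

lemma tanh_hyp_dist: "tanh (hyp_dist z w) = norm (disc_phi z w)"
  unfolding hyp_dist_eq_artanh using norm_disc_phi_less_1 by (intro tanh_artanh_real) auto

lemma hyp_dist_nonneg: "0 \<le> hyp_dist z w"
  using norm_disc_phi_less_1 by (auto simp: hyp_dist_def intro!: ln_ge_zero)

lemma hyp_dist_pos: "z \<noteq> w \<Longrightarrow> 0 < hyp_dist z w"
  using norm_disc_phi_less_1 one_minus_cnj_mult_pos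
  by (auto simp: hyp_dist_def norm_disc_phi intro!: ln_gt_zero)

text \<open>With r = |\<phi>|, the quotient (1 + r) / (1 - r) = (1 + r)^2 / (1 - r^2) lies between 1
  / (1 - r^2) and 4 / (1 - r^2), and 1 - |x|^2 lies between 1 - |x| and 2 (1 - |x|). Together with
  \<open>hyp_dist_ge\<close> this says that e^(2 \<beta>) equals |1 - cnj z * w|^2 / ((1 - |z|) (1 -
  |w|)) up to a factor 4 in either direction.\<close>

lemma hyp_dist_le:
  "hyp_dist z w \<le> 1 / 2 * ln (4 * (norm (1 - cnj z * w))\<^sup>2 / ((1 - norm z) * (1 - norm w)))"
proof -
  define r where "r = norm (disc_phi z w)"
  have r: "0 \<le> r" "r < 1" using norm_disc_phi_less_1 by (auto simp: r_def)
  have r_sq: "1 - r\<^sup>2 = (1 - r) * (1 + r)" by (simp add: power2_eq_square algebra_simps)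
  have "(1 + r) / (1 - r) = (1 + r)\<^sup>2 / (1 - r\<^sup>2)"
    using r r_sq by (simp add: power2_eq_square)
  also have "\<dots> \<le> 4 / (1 - r\<^sup>2)"
    using r power_mono[of "1 + r" 2 2]
    by (intro divide_right_mono) (auto simp: power_le_one)
  also have "\<dots> = 4 * (norm (1 - cnj z * w))\<^sup>2 / ((1 - (norm z)\<^sup>2) * (1 - (norm w)\<^sup>2))"
    using one_minus_cnj_mult_pos unfolding r_def one_minus_norm_disc_phi_sq by simp
  also have "\<dots> \<le> 4 * (norm (1 - cnj z * w))\<^sup>2 / ((1 - norm z) * (1 - norm w))"
  proof (rule divide_left_mono)
    have "(norm z)\<^sup>2 \<le> norm z" "(norm w)\<^sup>2 \<le> norm w"
      using zw by (auto simp: power2_eq_square mult_le_cancel_left2)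
    then show "(1 - norm z) * (1 - norm w) \<le> (1 - (norm z)\<^sup>2) * (1 - (norm w)\<^sup>2)"
      using zw by (intro mult_mono) auto
    then show "0 < (1 - (norm z)\<^sup>2) * (1 - (norm w)\<^sup>2) * ((1 - norm z) * (1 - norm w))"
      using zw by (intro mult_pos_pos) (auto simp: power_less_one_iff)
  qed auto
  finally show ?thesis
    using r unfolding hyp_dist_def r_def[symmetric]
    by (intro mult_left_mono ln_mono) auto
qed

lemma hyp_dist_ge:
  "1 / 2 * ln ((norm (1 - cnj z * w))\<^sup>2 / (4 * ((1 - norm z) * (1 - norm w)))) \<le> hyp_dist z w"
proof -
  define r where "r = norm (disc_phi z w)"
  have r: "0 \<le> r" "r < 1" using norm_disc_phi_less_1 by (auto simp: r_def)
  have r_sq: "1 - r\<^sup>2 = (1 - r) * (1 + r)" by (simp add: power2_eq_square algebra_simps)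
  have "(norm (1 - cnj z * w))\<^sup>2 / (4 * ((1 - norm z) * (1 - norm w)))
      \<le> (norm (1 - cnj z * w))\<^sup>2 / ((1 - (norm z)\<^sup>2) * (1 - (norm w)\<^sup>2))"
  proof (rule divide_left_mono)
    have "1 - (norm x)\<^sup>2 \<le> 2 * (1 - norm x)" for x :: complex
      using zero_le_power2[of "1 - norm x"] unfolding power2_diff by simp
    from mult_mono[OF this[of z] this[of w]]
    show "(1 - (norm z)\<^sup>2) * (1 - (norm w)\<^sup>2) \<le> 4 * ((1 - norm z) * (1 - norm w))"
      using zw by (auto simp: power_le_one algebra_simps)
    show "0 < 4 * ((1 - norm z) * (1 - norm w)) * ((1 - (norm z)\<^sup>2) * (1 - (norm w)\<^sup>2))"
      using zw by (intro mult_pos_pos) (auto simp: power_less_one_iff)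
  qed auto
  also have "\<dots> = 1 / (1 - r\<^sup>2)"
    unfolding r_def one_minus_norm_disc_phi_sq by simp
  also have "\<dots> \<le> (1 + r)\<^sup>2 / (1 - r\<^sup>2)"
    using r by (intro divide_right_mono) (auto simp: power_le_one one_le_power)
  also have "\<dots> = (1 + r) / (1 - r)"
    using r r_sq by (simp add: power2_eq_square)
  finally have "(norm (1 - cnj z * w))\<^sup>2 / (4 * ((1 - norm z) * (1 - norm w))) \<le> (1 + r) / (1 - r)" .
  moreover have "0 < (norm (1 - cnj z * w))\<^sup>2 / (4 * ((1 - norm z) * (1 - norm w)))"
    using zw one_minus_cnj_mult_pos by (intro divide_pos_pos mult_pos_pos) auto
  ultimately show ?thesis
    unfolding hyp_dist_def r_def[symmetric] by simp
qed

end

section \<open>Moebius invariance, the triangle inequality and geodesics\<close>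

lemma disc_phi_isometry:
  assumes "norm a < 1" "norm z < 1" "norm w < 1"
  shows "norm (disc_phi (disc_phi a z) (disc_phi a w)) = norm (disc_phi z w)"
proof -
  \<comment> \<open>Numerator and denominator of the transformed quotient acquire the same modulus
    factor (1 - |a|^2) / (|p| |q|), which cancels.\<close>
  define p q where "p = 1 - cnj a * z" and "q = 1 - cnj a * w"
  have nz: "p \<noteq> 0" "q \<noteq> 0" "cnj p \<noteq> 0"
    using one_minus_cnj_mult_pos[of a z] one_minus_cnj_mult_pos[of a w] assms
    unfolding p_def q_def complex_cnj_zero_iff zero_less_norm_iff by blast+
  have n: "1 - (norm a)\<^sup>2 > 0" using assms by (simp add: power_less_one_iff)
  have aa: "cnj a * a = of_real ((norm a)\<^sup>2)"
    by (metis complex_norm_square mult.commute)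
  have "disc_phi a z - disc_phi a w = (w - z) * (1 - cnj a * a) / (p * q)"
    using nz by (simp add: disc_phi_def p_def[symmetric] q_def[symmetric] divide_simps)
      (simp add: p_def q_def algebra_simps)
  also have "1 - cnj a * a = of_real (1 - (norm a)\<^sup>2)" by (simp add: aa)
  finally have 1: "norm (disc_phi a z - disc_phi a w)
      = norm (z - w) * (1 - (norm a)\<^sup>2) / (norm p * norm q)"
    using n by (simp add: norm_mult norm_divide norm_minus_commute del: of_real_diff)
  have "1 - cnj (disc_phi a z) * disc_phi a w = (1 - cnj a * a) * (1 - cnj z * w) / (cnj p * q)"
    using nz by (simp add: disc_phi_def p_def[symmetric] q_def[symmetric] divide_simps)
      (simp add: p_def q_def algebra_simps)
  also have "1 - cnj a * a = of_real (1 - (norm a)\<^sup>2)" by (simp add: aa)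
  finally have 2: "norm (1 - cnj (disc_phi a z) * disc_phi a w)
      = (1 - (norm a)\<^sup>2) * norm (1 - cnj z * w) / (norm p * norm q)"
    using n by (simp add: norm_mult norm_divide del: of_real_diff)
  show ?thesis
    unfolding norm_disc_phi[of "disc_phi a z"] norm_disc_phi[of z] 1 2 using n nz by simp
qed

lemma hyp_dist_isometry:
  assumes "norm a < 1" "norm z < 1" "norm w < 1"
  shows "hyp_dist (disc_phi a z) (disc_phi a w) = hyp_dist z w"
  by (simp add: hyp_dist_def disc_phi_isometry[OF assms])

lemma disc_phi_involution:
  assumes "norm a < 1" "norm z < 1"
  shows "disc_phi a (disc_phi a z) = z"
proof -
  define p where "p = 1 - cnj a * z"
  have nz: "p \<noteq> 0"
    using one_minus_cnj_mult_pos[of a z] assms by (auto simp: p_def)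
  have "cnj a * a = of_real ((norm a)\<^sup>2)"
    by (metis complex_norm_square mult.commute)
  moreover have "(norm a)\<^sup>2 \<noteq> 1" using assms power_less_one_iff[of "norm a" 2] by auto
  ultimately have aa: "1 - cnj a * a \<noteq> 0"
    by (metis eq_iff_diff_eq_0 of_real_1 of_real_eq_iff)
  have "a - disc_phi a z = z * (1 - cnj a * a) / p"
    using nz by (simp add: disc_phi_def p_def[symmetric] divide_simps) (simp add: p_def algebra_simps)
  moreover have "1 - cnj a * disc_phi a z = (1 - cnj a * a) / p"
    using nz by (simp add: disc_phi_def p_def[symmetric] divide_simps) (simp add: p_def algebra_simps)
  ultimately show ?thesis
    unfolding disc_phi_def[of a "disc_phi a z"] using nz aa by simp
qed

text \<open>The isometry \<open>disc_phi v\<close> moves the middle point to 0, so that only the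
  moduli x and y of the images of z and w matter. Their pseudohyperbolic distance is at most (x + y)
  / (1 + x y), which is the addition formula of tanh.\<close>

lemma hyp_dist_triangle:
  assumes "norm z < 1" "norm v < 1" "norm w < 1"
  shows "hyp_dist z w \<le> hyp_dist z v + hyp_dist v w"
proof -
  define a b where "a = disc_phi v z" and "b = disc_phi v w"
  define x y where "x = norm a" and "y = norm b"
  define r where "r = norm (disc_phi z w)"
  have x: "0 \<le> x" "x < 1" and y: "0 \<le> y" "y < 1" and r: "0 \<le> r" "r < 1"
    using norm_disc_phi_less_1 assms by (auto simp: x_def y_def a_def b_def r_def)
  have r_ab: "r = norm (disc_phi a b)"
    unfolding r_def a_def b_def using assms by (simp add: disc_phi_isometry)
  have "norm (1 - cnj a * b) \<le> 1 + x * y"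
    using norm_triangle_ineq4[of 1 "cnj a * b"] by (simp add: norm_mult x_def y_def)
  then have "(1 - x\<^sup>2) * (1 - y\<^sup>2) / (1 + x * y)\<^sup>2 \<le> (1 - x\<^sup>2) * (1 - y\<^sup>2) / (norm (1 - cnj a * b))\<^sup>2"
    using x y one_minus_cnj_mult_pos[of a b]
    by (intro divide_left_mono power_mono mult_nonneg_nonneg mult_pos_pos)
      (auto simp: power_le_one x_def y_def intro!: add_pos_nonneg)
  also have "\<dots> = 1 - r\<^sup>2"
    using one_minus_norm_disc_phi_sq[of a b] x y by (simp add: r_ab x_def y_def)
  finally have *: "(1 - x\<^sup>2) * (1 - y\<^sup>2) / (1 + x * y)\<^sup>2 \<le> 1 - r\<^sup>2" .
  have xy: "0 < 1 + x * y" using x y by (simp add: add_pos_nonneg)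
  \<comment> \<open>This is the value that 1 - r^2 would give for opposite points of a diameter,
    where |1 - cnj a * b| attains its maximum 1 + x y.\<close>
  have "((x + y) / (1 + x * y))\<^sup>2 = 1 - (1 - x\<^sup>2) * (1 - y\<^sup>2) / (1 + x * y)\<^sup>2"
    using xy by (simp add: power_divide divide_simps) (simp add: power2_eq_square algebra_simps)
  with * have "r\<^sup>2 \<le> ((x + y) / (1 + x * y))\<^sup>2" by linarith
  then have rle: "r \<le> (x + y) / (1 + x * y)"
    by (rule power2_le_imp_le) (use x y xy in auto)
  have "(1 + r) / (1 - r) \<le> (1 + x) / (1 - x) * ((1 + y) / (1 - y))"
  proof -
    have "r * (1 + x * y) \<le> x + y" using rle xy by (simp add: pos_le_divide_eq)
    then have "(1 + r) * ((1 - x) * (1 - y)) \<le> (1 + x) * (1 + y) * (1 - r)"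
      by (simp add: algebra_simps)
    then show ?thesis using x y r by (simp add: divide_simps mult.commute)
  qed
  then have "ln ((1 + r) / (1 - r)) \<le> ln ((1 + x) / (1 - x) * ((1 + y) / (1 - y)))"
    using r x y by simp
  also have "\<dots> = ln ((1 + x) / (1 - x)) + ln ((1 + y) / (1 - y))"
    using x y by (intro ln_mult_pos) auto
  finally show ?thesis
    using norm_disc_phi_commute[of z v] by (simp add: hyp_dist_def x_def y_def r_def a_def b_def)
qed

text \<open>A Euclidean ball of half the boundary distance has pseudohyperbolic radius at most 1/2,
  and (1 + 1/2) / (1 - 1/2) = 3, so \<beta> \<le> (1/2) ln 3 \<le> 1.\<close>

lemma hyp_dist_le_1:
  assumes "norm z < 1" "norm (w - z) \<le> (1 - norm z) / 2"
  shows "norm w < 1" "hyp_dist z w \<le> 1"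
proof -
  show w: "norm w < 1"
    using norm_triangle_ineq2[of w z] assms by (simp add: field_simps)
  define r where "r = norm (disc_phi z w)"
  have "norm (z - w) \<le> 1/2 * norm (1 - cnj z * w)"
    using assms norm_one_minus_cnj_mult_ge[of w z] w by (simp add: norm_minus_commute)
  then have "r \<le> 1/2"
    using one_minus_cnj_mult_pos[OF assms(1) w] by (simp add: r_def norm_disc_phi divide_simps)
  moreover have "0 \<le> r" by (simp add: r_def)
  ultimately have "(1 + r) / (1 - r) \<le> 3" "0 < (1 + r) / (1 - r)" by (auto simp: divide_simps)
  then have "ln ((1 + r) / (1 - r)) \<le> (1 + r) / (1 - r) - 1" by (intro ln_le_minus_one)
  with \<open>(1 + r) / (1 - r) \<le> 3\<close> show "hyp_dist z w \<le> 1"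
    unfolding hyp_dist_def r_def[symmetric] by simp
qed

text \<open>The converse inclusion of balls. From |z - w| \<le> (1/17) |1 - cnj z * w| and |1 - cnj
  z * w| \<le> 2 (1 - |z|) + |z - w| one gets 16 |z - w| \<le> 2 (1 - |z|); this is why 17 is paired
  with 8.\<close>

lemma norm_diff_le_of_hyp_dist:
  assumes "norm z < 1" "norm w < 1" "hyp_dist z w \<le> artanh (1/17)"
  shows "norm (w - z) \<le> (1 - norm z) / 8"
proof -
  have "norm (disc_phi z w) \<le> tanh (artanh (1/17))"
    using assms by (simp flip: tanh_hyp_dist)
  then have "norm (disc_phi z w) \<le> 1/17" by (simp add: tanh_artanh_real)
  then have "norm (z - w) \<le> 1/17 * norm (1 - cnj z * w)"
    using one_minus_cnj_mult_pos[OF assms(1,2)] by (simp add: norm_disc_phi divide_simps)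
  moreover have "norm (1 - cnj z * w) \<le> 2 * (1 - norm z) + norm (z - w)"
  proof -
    have "1 - cnj z * w = of_real (1 - (norm z)\<^sup>2) + cnj z * (z - w)"
      using complex_norm_square[of z] by (simp add: algebra_simps)
    then have "norm (1 - cnj z * w) \<le> \<bar>1 - (norm z)\<^sup>2\<bar> + norm z * norm (z - w)"
      using norm_triangle_ineq[of "of_real (1 - (norm z)\<^sup>2)" "cnj z * (z - w)"]
      by (simp add: norm_mult del: of_real_diff)
    also have "\<bar>1 - (norm z)\<^sup>2\<bar> \<le> 2 * (1 - norm z)"
      using zero_le_power2[of "1 - norm z"] assms
      unfolding power2_diff by (simp add: power_le_one)
    also have "norm z * norm (z - w) \<le> norm (z - w)"
      using assms by (simp add: mult_left_le_one_le)
    finally show ?thesis by simp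
  qed
  ultimately show ?thesis by (simp add: norm_minus_commute)
qed

text \<open>The disc automorphism exchanging \<open>z\<close> and 0 turns a geodesic through \<open>z\<close> into a diameter.\<close>

lemma hyp_dist_intermediate:
  assumes "norm z < 1" "norm w < 1" "0 < h" "h \<le> hyp_dist z w"
  obtains v where "norm v < 1" "hyp_dist z v = hyp_dist z w - h" "hyp_dist v w = h"
proof -
  define a where "a = disc_phi z w"
  define r s where "r = norm a" and "s = tanh (hyp_dist z w - h)"
  have r1: "r < 1" using norm_disc_phi_less_1 assms by (simp add: r_def a_def)
  have a: "tanh (hyp_dist z w) = r"
    using assms by (simp add: a_def r_def tanh_hyp_dist)
  have s: "0 \<le> s" "s < r"
    using assms unfolding s_def a[symmetric] by simp_all
  \<comment> \<open>In the picture with \<open>z\<close> moved to 0, this is the point of the radius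
    towards \<open>a\<close> at hyperbolic distance \<open>hyp_dist z w - h\<close> from 0. Its
    image under \<open>disc_phi z\<close> is the required point.\<close>
  define v where "v = of_real (s / r) * a"
  have r0: "0 < r" using s by linarith
  have nv: "norm v = s" using s r0 by (simp add: v_def norm_mult norm_divide r_def)
  have phi0: "disc_phi 0 v = - v" "disc_phi z 0 = z" by (simp_all add: disc_phi_def)
  define v' where "v' = disc_phi z v"
  have v': "norm v' < 1" using nv s r1 assms norm_disc_phi_less_1[of z v] by (simp add: v'_def)
  have vlt: "norm v < 1" using nv s r1 by simp
  have w_eq: "disc_phi z a = w"
    using assms by (simp add: a_def disc_phi_involution)
  have d1: "hyp_dist z v' = hyp_dist z w - h"
  proof -
    have "hyp_dist z v' = hyp_dist 0 v"
      using hyp_dist_isometry[of z 0 v] assms vlt by (simp add: v'_def phi0)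
    also have "\<dots> = artanh s" using vlt nv by (simp add: hyp_dist_eq_artanh phi0)
    also have "\<dots> = hyp_dist z w - h" by (simp add: s_def artanh_tanh_real)
    finally show ?thesis .
  qed
  have "norm (disc_phi v a) = tanh h"
  proof -
    have "v - a = of_real (s / r - 1) * a" by (simp add: v_def algebra_simps)
    then have 1: "norm (v - a) = r - s"
      using s r0 by (simp add: norm_mult r_def[symmetric] field_simps del: of_real_diff of_real_divide)
    have "cnj v * a = of_real (s * r)"
    proof -
      have "cnj v * a = of_real (s / r) * of_real (r\<^sup>2)"
        unfolding v_def r_def complex_norm_square by (simp add: mult_ac)
      then show ?thesis using r0 by (simp add: power2_eq_square)
    qed
    then have "1 - cnj v * a = of_real (1 - s * r)" by simp
    then have 2: "norm (1 - cnj v * a) = 1 - s * r"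
      using s r1 r0 mult_le_one[of s r] by (simp del: of_real_diff of_real_mult)
    have h: "h = hyp_dist z w + - (hyp_dist z w - h)" by simp
    have "tanh h = (r + - s) / (1 + r * - s)"
      by (subst h, subst tanh_add) (auto simp: s_def a simp del: minus_diff_eq)
    then show ?thesis unfolding norm_disc_phi 1 2 by (simp add: mult.commute)
  qed
  then have "hyp_dist v a = h"
    using vlt r1 by (simp add: hyp_dist_eq_artanh r_def artanh_tanh_real)
  then have "hyp_dist v' w = h"
    using hyp_dist_isometry[of z v a] assms vlt r1 w_eq by (simp add: v'_def r_def)
  with that v' d1 show thesis by blast
qed

text \<open>Walk along the geodesic from \<open>w\<close> towards \<open>z\<close> in steps of
  hyperbolic length \<open>h\<close>, each costing at most \<open>K\<close>. The last, possibly
  shorter, step accounts for the additive \<open>K\<close>.\<close>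

lemma hyp_chain:
  fixes F :: "complex \<Rightarrow> real"
  assumes h: "0 < h" and K: "0 \<le> K"
    and step: "\<And>z w. norm z < 1 \<Longrightarrow> norm w < 1 \<Longrightarrow> hyp_dist z w \<le> h \<Longrightarrow> \<bar>F z - F w\<bar> \<le> K"
    and zw: "norm z < 1" "norm w < 1"
  shows "\<bar>F z - F w\<bar> \<le> K / h * hyp_dist z w + K"
proof -
  have *: "\<bar>F z - F w\<bar> \<le> real n * K" if "hyp_dist z w \<le> real n * h" "norm w < 1" "n > 0" for n w
    using that
  proof (induction n arbitrary: w)
    case (Suc n)
    show ?case
    proof (cases "hyp_dist z w \<le> h")
      case True
      then have "\<bar>F z - F w\<bar> \<le> 1 * K" using step zw Suc by simp
      also have "\<dots> \<le> real (Suc n) * K" using K by (intro mult_right_mono) auto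
      finally show ?thesis .
    next
      case False
      then have "n > 0" using Suc.prems by (cases n) auto
      obtain v where v: "norm v < 1" "hyp_dist z v = hyp_dist z w - h" "hyp_dist v w = h"
        using hyp_dist_intermediate[of z w h] zw Suc.prems h False by auto
      have "\<bar>F z - F v\<bar> \<le> real n * K"
        using Suc.prems \<open>n > 0\<close> v by (intro Suc.IH) (auto simp: algebra_simps)
      moreover have "\<bar>F v - F w\<bar> \<le> K" using step v Suc.prems by simp
      ultimately show ?thesis by (simp add: algebra_simps)
    qed
  qed simp
  \<comment> \<open>Adding 1 to the floor keeps n positive and makes n steps reach the whole
    distance, while n still exceeds the quotient by at most 1.\<close>
  define n where "n = nat \<lfloor>hyp_dist z w / h\<rfloor> + 1"
  have d: "0 \<le> hyp_dist z w / h" using hyp_dist_nonneg zw h by simp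
  then have "hyp_dist z w / h \<le> real n" "real n \<le> hyp_dist z w / h + 1"
    by (simp_all add: n_def) linarith+
  then have "hyp_dist z w \<le> real n * h" "real n * K \<le> (hyp_dist z w / h + 1) * K"
    using h K by (auto simp: pos_divide_le_eq intro: mult_right_mono)
  with *[of w n] zw show ?thesis by (simp add: n_def algebra_simps)
qed

section \<open>Area integrals over polar boxes\<close>

lemma space_disc_area [simp]: "space disc_area = unit_disc"
  by (simp add: disc_area_def space_scale_measure)

lemma sets_disc_area_Int [intro]: "A \<in> sets borel \<Longrightarrow> A \<inter> unit_disc \<in> sets disc_area"
  by (auto simp: disc_area_def sets_restrict_space)

lemma emeasure_disc_area:
  assumes "A \<in> sets borel" "A \<subseteq> unit_disc"
  shows "emeasure disc_area A = ennreal (1 / pi) * emeasure lborel A"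
  using assms by (simp add: disc_area_def emeasure_restrict_space)

lemma emeasure_lborel_ball_complex:
  fixes c :: complex
  assumes "0 \<le> r"
  shows "emeasure lborel (ball c r) = ennreal (pi * r\<^sup>2)"
  using emeasure_ball[OF assms, of c] by (simp add: unit_ball_vol_2)

lemma emeasure_disc_area_ball_le:
  assumes "0 \<le> r"
  shows "emeasure disc_area (ball c r \<inter> unit_disc) \<le> ennreal (r\<^sup>2)"
proof -
  have "emeasure disc_area (ball c r \<inter> unit_disc) = ennreal (1 / pi) * emeasure lborel (ball c r \<inter> unit_disc)"
    by (intro emeasure_disc_area) auto
  also have "\<dots> \<le> ennreal (1 / pi) * emeasure lborel (ball c r)"
    by (intro mult_left_mono emeasure_mono) auto
  also have "\<dots> = ennreal (r\<^sup>2)"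
    using assms by (simp add: emeasure_lborel_ball_complex flip: ennreal_mult)
  finally show ?thesis .
qed

lemma emeasure_disc_area_ball:
  assumes "0 \<le> r" "ball c r \<subseteq> unit_disc"
  shows "emeasure disc_area (ball c r) = ennreal (r\<^sup>2)"
  using assms by (simp add: emeasure_disc_area emeasure_lborel_ball_complex flip: ennreal_mult)

lemma finite_measure_disc_area: "finite_measure disc_area"
  using emeasure_disc_area_ball[of 1 0] by (intro finite_measureI) simp

section \<open>Polar coordinates and boxes at the boundary\<close>

lemma norm_cis_diff_le: "norm (cis a - cis b) \<le> \<bar>a - b\<bar>"
proof -
  have "cis a - cis b = cis b * (cis (a - b) - 1)"
    by (simp add: algebra_simps cis_mult)
  then have "norm (cis a - cis b) = norm (cis (a - b) - 1)"
    by (simp add: norm_mult)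
  also have "\<dots> = 2 * \<bar>sin ((a - b) / 2)\<bar>"
    using dist_exp_i_1[of "a - b"] by (simp add: cis_conv_exp)
  also have "\<dots> \<le> \<bar>a - b\<bar>"
    using abs_sin_x_le_abs_x[of "(a - b) / 2"] by simp
  finally show ?thesis .
qed

text \<open>Produces an argument of \<open>z\<close> close to the given argument of
  \<open>c\<close>, with no jump at a branch cut: the quotient z / c lies near 1, where its
  principal argument is arctan (Im / Re) with Re \<ge> 1/2.\<close>

lemma polar_near:
  assumes c: "c \<noteq> 0" "c = of_real (norm c) * cis \<theta>"
    and z: "norm (z - c) \<le> e * norm c" and e: "e \<le> 1 / 2"
  obtains \<phi> where "\<bar>\<phi> - \<theta>\<bar> \<le> 2 * e" "z = of_real (norm z) * cis \<phi>" "z \<noteq> 0"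
proof -
  define v where "v = z / c"
  have "v - 1 = (z - c) / c" using c by (simp add: v_def diff_divide_distrib)
  then have v: "norm (v - 1) \<le> e"
    using z c by (simp add: norm_divide pos_divide_le_eq)
  have "\<bar>Re v - 1\<bar> \<le> e" "\<bar>Im v\<bar> \<le> e"
    using abs_Re_le_cmod[of "v - 1"] abs_Im_le_cmod[of "v - 1"] v by auto
  then have Re: "1 / 2 \<le> Re v" and Im: "\<bar>Im v\<bar> \<le> e" using e by auto
  then have v0: "v \<noteq> 0" by auto
  have "\<bar>Arg v\<bar> \<le> \<bar>Im v / Re v\<bar>"
    using Re by (subst arg_conv_arctan) (auto simp del: abs_divide intro: abs_arctan_le)
  also have "\<dots> \<le> 2 * e"
  proof -
    have "\<bar>Im v\<bar> * 1 \<le> 2 * e * Re v"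
      using Im Re mult_mono[of "\<bar>Im v\<bar>" e 1 "2 * Re v"] by (simp add: mult_ac)
    then show ?thesis using Re by (simp add: abs_divide pos_divide_le_eq)
  qed
  finally have "\<bar>(\<theta> + Arg v) - \<theta>\<bar> \<le> 2 * e" by simp
  moreover have "z = of_real (norm z) * cis (\<theta> + Arg v)"
  proof -
    have "z = c * v" using c by (simp add: v_def)
    moreover have "v = of_real (norm v) * cis (Arg v)"
      using rcis_cmod_Arg[of v] by (simp add: rcis_def)
    ultimately have "z = of_real (norm c) * cis \<theta> * (of_real (norm v) * cis (Arg v))"
      using c by metis
    also have "\<dots> = of_real (norm z) * cis (\<theta> + Arg v)"
      using \<open>z = c * v\<close> by (simp add: norm_mult cis_mult[symmetric])
    finally show ?thesis .
  qed
  moreover have "z \<noteq> 0" using v0 by (auto simp: v_def)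
  ultimately show thesis using that by blast
qed

text \<open>A version of the Carleson square with angular half-width and depth both
  \<open>l\<close>. The angle is any real representative, so no branch of the argument has to be
  fixed; for l > 1 the origin belongs to the box.\<close>

definition polar_box :: "real \<Rightarrow> real \<Rightarrow> complex set" where
  "polar_box \<theta> l = {z. norm z < 1 \<and> 1 - norm z < l \<and>
     (\<exists>\<phi>. \<bar>\<phi> - \<theta>\<bar> \<le> l \<and> z = of_real (norm z) * cis \<phi>)}"

lemma dist_polar_le:
  assumes "norm z \<le> 1" "z = of_real (norm z) * cis \<phi>"
  shows "dist (cis t) z \<le> (1 - norm z) + \<bar>\<phi> - t\<bar>"
proof -
  have "norm (z - cis \<phi>) = 1 - norm z"
  proof -
    have "z - cis \<phi> = of_real (norm z - 1) * cis \<phi>"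
      using assms(2) by (simp add: algebra_simps)
    then have "norm (z - cis \<phi>) = \<bar>norm z - 1\<bar> * 1"
      by (metis norm_mult norm_of_real norm_cis)
    with assms show ?thesis by simp
  qed
  then show ?thesis
    using norm_triangle_ineq[of "z - cis \<phi>" "cis \<phi> - cis t"] norm_cis_diff_le[of \<phi> t]
    by (simp add: dist_norm norm_minus_commute)
qed

lemma polar_box_subset_ball: "polar_box \<theta> l \<subseteq> ball (cis \<theta>) (2 * l)"
proof
  fix z assume "z \<in> polar_box \<theta> l"
  then obtain \<phi> where "norm z < 1" "1 - norm z < l" "\<bar>\<phi> - \<theta>\<bar> \<le> l" "z = of_real (norm z) * cis \<phi>"
    by (auto simp: polar_box_def)
  with dist_polar_le[of z \<phi> \<theta>] show "z \<in> ball (cis \<theta>) (2 * l)" by simp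
qed

text \<open>The angle relative to \<theta> can be taken as a principal argument, and \<pi> <
  4.\<close>

lemma unit_disc_subset_polar_box: "unit_disc \<subseteq> polar_box \<theta> 4"
proof
  fix z :: complex assume z: "z \<in> unit_disc"
  define \<phi> where "\<phi> = \<theta> + Arg (z * cis (- \<theta>))"
  have "z = z * cis (- \<theta>) * cis \<theta>" by (simp add: cis_mult)
  also have "z * cis (- \<theta>) = of_real (norm z) * cis (Arg (z * cis (- \<theta>)))"
    using rcis_cmod_Arg[of "z * cis (- \<theta>)"] by (simp add: rcis_def norm_mult)
  finally have "z = of_real (norm z) * cis \<phi>" by (simp add: \<phi>_def cis_mult[symmetric] mult_ac)
  moreover have "\<bar>\<phi> - \<theta>\<bar> \<le> 4"
    using Arg_bounded[of "z * cis (- \<theta>)"] pi_less_4 unfolding \<phi>_def by linarith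
  moreover have "1 - norm z < 4" using norm_ge_zero[of z] by linarith
  ultimately show "z \<in> polar_box \<theta> 4" using z by (auto simp: polar_box_def)
qed

text \<open>The part of \<open>polar_box \<theta> l\<close> at depth \<open>l / 2^k\<close> is covered by \<open>2^k\<close> balls centred on the
  circle; this replaces polar coordinates.\<close>

definition layer_cover :: "real \<Rightarrow> real \<Rightarrow> nat \<Rightarrow> complex set" where
  "layer_cover \<theta> l k =
     (\<Union>i<2^k. ball (cis (\<theta> - l + (2 * real i + 1) * l / 2^k)) (2 * l / 2^k) \<inter> unit_disc)"

lemma layer_cover_sets: "layer_cover \<theta> l k \<in> sets disc_area"
  unfolding layer_cover_def by (intro sets.finite_UN) auto

lemma emeasure_layer_cover_le:
  assumes "0 < l"
  shows "emeasure disc_area (layer_cover \<theta> l k) \<le> ennreal (4 * l\<^sup>2 / 2^k)"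
proof -
  have "emeasure disc_area (layer_cover \<theta> l k)
      \<le> (\<Sum>i<2^k. emeasure disc_area (ball (cis (\<theta> - l + (2 * real i + 1) * l / 2^k)) (2 * l / 2^k) \<inter> unit_disc))"
    unfolding layer_cover_def by (intro emeasure_subadditive_finite) auto
  also have "\<dots> \<le> (\<Sum>i<(2::nat)^k. ennreal ((2 * l / 2^k)\<^sup>2))"
    using assms by (intro sum_mono emeasure_disc_area_ball_le) auto
  also have "\<dots> = ennreal (\<Sum>i<(2::nat)^k. (2 * l / 2^k)\<^sup>2)"
    by (intro sum_ennreal) auto
  also have "(\<Sum>i<(2::nat)^k. (2 * l / 2^k)\<^sup>2) = 4 * l\<^sup>2 / 2^k"
    by (simp add: power2_eq_square field_simps)
  finally show ?thesis .
qed

lemma polar_box_subset_layer_cover: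
  assumes z: "z \<in> polar_box \<theta> l" and d: "1 - norm z < l / 2^k" and l: "0 < l"
  shows "z \<in> layer_cover \<theta> l k"
proof -
  obtain \<phi> where phi: "norm z < 1" "\<bar>\<phi> - \<theta>\<bar> \<le> l" "z = of_real (norm z) * cis \<phi>"
    using z by (auto simp: polar_box_def)
  \<comment> \<open>The angular interval of length 2 l is rescaled to [0, 2^k]; the balls are
    centred at the midpoints of the unit cells.\<close>
  define t where "t = (\<phi> - \<theta> + l) / (2 * l) * 2^k"
  have t: "0 \<le> t" "t \<le> 2^k"
  proof -
    have "0 \<le> (\<phi> - \<theta> + l) / (2 * l)" "(\<phi> - \<theta> + l) / (2 * l) \<le> 1"
      using phi l by (auto simp: divide_simps)
    then show "0 \<le> t" "t \<le> 2^k" 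
      unfolding t_def by (auto intro: mult_nonneg_nonneg mult_left_le_one_le simp del: times_divide_eq_left)
  qed
  obtain i :: nat where i: "i < 2^k" "\<bar>t - real i - 1 / 2\<bar> \<le> 1 / 2"
  proof (cases "t < 2^k")
    case True
    have "real (nat \<lfloor>t\<rfloor>) \<le> t" "t \<le> real (nat \<lfloor>t\<rfloor>) + 1" using t by linarith+
    moreover have "nat \<lfloor>t\<rfloor> < 2^k" 
      using True t \<open>real (nat \<lfloor>t\<rfloor>) \<le> t\<close> by (metis le_less_trans of_nat_less_iff of_nat_numeral of_nat_power)
    moreover have "\<bar>t - real (nat \<lfloor>t\<rfloor>) - 1 / 2\<bar> \<le> 1 / 2"
      using calculation by linarith
    ultimately show ?thesis by (intro that[of "nat \<lfloor>t\<rfloor>"])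
  next
    \<comment> \<open>The right endpoint of the last cell is not reached by the floor and is
      assigned to the last ball.\<close>
    case False
    then have "t = 2^k" using t by simp
    then show ?thesis by (intro that[of "2^k - 1"]) (auto simp: of_nat_diff)
  qed
  define \<theta>' where "\<theta>' = \<theta> - l + (2 * real i + 1) * l / 2^k"
  have "\<phi> = \<theta> - l + 2 * l / 2^k * t"
    using l by (simp add: t_def field_simps)
  then have "\<phi> - \<theta>' = 2 * l / 2^k * (t - real i - 1 / 2)"
    by (simp add: \<theta>'_def field_simps)
  then have "\<bar>\<phi> - \<theta>'\<bar> = 2 * l / 2^k * \<bar>t - real i - 1 / 2\<bar>"
    using l by (simp add: abs_mult)
  also have "\<dots> \<le> 2 * l / 2^k * (1 / 2)"
    using i l by (intro mult_left_mono) auto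
  finally have "dist (cis \<theta>') z < 2 * l / 2^k"
    using dist_polar_le[of z \<phi> \<theta>'] phi d by simp
  then show ?thesis using i phi by (auto simp: layer_cover_def \<theta>'_def)
qed

text \<open>Where the depth is between l / 2^(k+1) and l / 2^k, the integrand is at most 2^(s (k+1))
  and the point lies in layer k, whose area is at most 4 l^2 / 2^k. The resulting geometric series
  has ratio 2^(s-1), and s < 1 makes it converge.\<close>

lemma nn_integral_polar_box_le:
  assumes s: "0 \<le> s" "s < 1" and l: "0 < l"
  shows "(\<integral>\<^sup>+z. ennreal ((l / (1 - norm z)) powr s) * indicator (polar_box \<theta> l) z \<partial>disc_area)
    \<le> ennreal (4 * 2 powr s / (1 - 2 powr s / 2) * l\<^sup>2)"
proof -
  define q where "q = 2 powr s"
  have q: "0 < q" "q < 2" using s powr_less_mono[of s 1 2] by (auto simp: q_def)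
  have "(\<integral>\<^sup>+z. ennreal ((l / (1 - norm z)) powr s) * indicator (polar_box \<theta> l) z \<partial>disc_area)
      \<le> (\<integral>\<^sup>+z. (\<Sum>k. ennreal (q ^ Suc k) * indicator (layer_cover \<theta> l k) z) \<partial>disc_area)"
  proof (intro nn_integral_mono)
    fix z :: complex
    show "ennreal ((l / (1 - norm z)) powr s) * indicator (polar_box \<theta> l) z
        \<le> (\<Sum>k. ennreal (q ^ Suc k) * indicator (layer_cover \<theta> l k) z)"
    proof (cases "z \<in> polar_box \<theta> l")
      case True
      define x where "x = l / (1 - norm z)"
      have z: "norm z < 1" "1 - norm z < l" using True by (auto simp: polar_box_def)
      then have x: "1 < x" by (simp add: x_def)
      \<comment> \<open>The predecessor k of the least such n gives both bounds: 2^k < x places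
        \<open>z\<close> in layer k, and x \<le> 2^(k+1) bounds the integrand.\<close>
      define n where "n = (LEAST n. x \<le> 2 ^ n)"
      have ex: "\<exists>n. x \<le> 2 ^ n" using real_arch_pow[of 2 x] by (auto intro: less_imp_le)
      have n: "x \<le> 2 ^ n" unfolding n_def using ex by (rule LeastI_ex)
      then obtain k where k: "n = Suc k" using x by (cases n) auto
      have "\<not> x \<le> 2 ^ k" using not_less_Least[of k "\<lambda>n. x \<le> 2 ^ n"] k by (simp add: n_def[symmetric])
      then have "1 - norm z < l / 2 ^ k" using z by (simp add: x_def field_simps)
      then have "z \<in> layer_cover \<theta> l k" using polar_box_subset_layer_cover True l by blast
      have "x powr s \<le> (2 ^ Suc k) powr s" using n k x s by (intro powr_mono2) auto
      also have "\<dots> = q ^ Suc k"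
        by (simp add: q_def powr_powr powr_mult powr_realpow[symmetric] powr_add mult.commute)
      finally have "ennreal (x powr s) \<le> (\<Sum>j\<in>{k}. ennreal (q ^ Suc j) * indicator (layer_cover \<theta> l j) z)"
        using \<open>z \<in> layer_cover \<theta> l k\<close> by (simp add: ennreal_leI)
      also have "\<dots> \<le> (\<Sum>j. ennreal (q ^ Suc j) * indicator (layer_cover \<theta> l j) z)"
        by (intro sum_le_suminf) auto
      finally show ?thesis using True by (simp add: x_def)
    qed simp
  qed
  also have "\<dots> = (\<Sum>k. ennreal (q ^ Suc k) * emeasure disc_area (layer_cover \<theta> l k))"
    using layer_cover_sets by (subst nn_integral_suminf) (auto simp: nn_integral_cmult_indicator)
  also have "\<dots> \<le> (\<Sum>k. ennreal (4 * l\<^sup>2 * q * (q / 2) ^ k))"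
  proof (intro suminf_le allI)
    fix k
    have "ennreal (q ^ Suc k) * emeasure disc_area (layer_cover \<theta> l k)
        \<le> ennreal (q ^ Suc k) * ennreal (4 * l\<^sup>2 / 2^k)"
      using emeasure_layer_cover_le[OF l] by (intro mult_left_mono) auto
    also have "\<dots> = ennreal (4 * l\<^sup>2 * q * (q / 2) ^ k)"
      using q by (subst ennreal_mult[symmetric]) (auto simp: power_divide mult_ac)
    finally show "ennreal (q ^ Suc k) * emeasure disc_area (layer_cover \<theta> l k)
        \<le> ennreal (4 * l\<^sup>2 * q * (q / 2) ^ k)" .
  qed auto
  also have "\<dots> = ennreal (4 * l\<^sup>2 * q * (1 / (1 - q / 2)))"
    using q by (intro suminf_ennreal_eq sums_mult geometric_sums) auto
  finally show ?thesis by (simp add: q_def mult_ac)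
qed

section \<open>Arcs and Carleson squares\<close>

lemma cis_shift: "cis (x + 2 * pi * of_int n) = cis x"
  using sin_cos_eq_iff[of "x + 2 * pi * of_int n" x] by (auto simp: cis.ctr)

lemma cis_eq_cisD:
  assumes "cis x = cis y" 
  obtains n :: int where "x = y + 2 * pi * of_int n"
  using assms sin_cos_eq_iff[of x y] by (auto simp: complex_eq_iff)

text \<open>The open interval is a countable union of compact ones, whose images are compact; the
  endpoints contribute a finite set.\<close>

lemma cis_image_borel:
  assumes J: "{a<..<b} \<subseteq> J" "J \<subseteq> {a..b}"
  shows "cis ` J \<in> sets borel"
proof -
  have "{a<..<b} = (\<Union>n. {a + 1 / real (Suc n)..b - 1 / real (Suc n)})"
  proof (intro equalityI subsetI)
    fix x assume "x \<in> {a<..<b}"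
    then have "0 < min (x - a) (b - x)" by auto
    then obtain n where "1 / real (Suc n) < min (x - a) (b - x)"
      using nat_approx_posE by blast
    then have "x \<in> {a + 1 / real (Suc n)..b - 1 / real (Suc n)}" by auto
    then show "x \<in> (\<Union>n. {a + 1 / real (Suc n)..b - 1 / real (Suc n)})" by blast
  next
    fix x assume "x \<in> (\<Union>n. {a + 1 / real (Suc n)..b - 1 / real (Suc n)})"
    then obtain n where "a + 1 / real (Suc n) \<le> x" "x \<le> b - 1 / real (Suc n)" by auto
    moreover have "0 < 1 / real (Suc n)" by simp
    ultimately have "a < x" "x < b" by linarith+
    then show "x \<in> {a<..<b}" by simp
  qed
  then have "cis ` {a<..<b} = (\<Union>n. cis ` {a + 1 / real (Suc n)..b - 1 / real (Suc n)})"
    by blast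
  moreover have "compact (cis ` {c..d})" for c d
    by (intro compact_continuous_image) (auto intro: continuous_intros)
  ultimately have 1: "cis ` {a<..<b} \<in> sets borel"
    by (metis (no_types, lifting) borel_compact rangeE sets.countable_UN subsetI)
  have "J = {a<..<b} \<union> (J \<inter> {a, b})" using J by fastforce
  then have "cis ` J = cis ` {a<..<b} \<union> cis ` (J \<inter> {a, b})" by blast
  moreover have "finite (cis ` (J \<inter> {a, b}))" by simp
  ultimately show ?thesis
    using 1 by (metis borel_closed finite_imp_closed sets.Un)
qed

lemma emeasure_circle_measure:
  assumes "I \<in> sets borel"
  shows "emeasure circle_measure I = emeasure lborel {x \<in> {-pi<..pi}. cis x \<in> I}"
proof -
  have meas: "cis \<in> measurable borel borel"
    by (intro borel_measurable_continuous_onI continuous_intros)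
  then have "cis -` I \<in> sets borel" using measurable_sets[OF meas assms] by simp
  moreover have "cis -` I \<inter> {-pi<..pi} = {x \<in> {-pi<..pi}. cis x \<in> I}" by auto
  moreover have "cis \<in> measurable (restrict_space lborel {-pi<..pi}) borel"
    using meas by (intro measurable_restrict_space1) simp
  ultimately have "emeasure circle_measure I
      = emeasure (restrict_space lborel {-pi<..pi}) {x \<in> {-pi<..pi}. cis x \<in> I}"
    unfolding circle_measure_def using assms by (simp add: emeasure_distr space_restrict_space)
  also have "\<dots> = emeasure lborel {x \<in> {-pi<..pi}. cis x \<in> I}"
    by (intro emeasure_restrict_space) auto
  finally show ?thesis .
qed

text \<open>After a shift by a multiple of 2 \<pi> the left endpoint lies in the fundamental
  interval. The preimage of the arc there is then, up to endpoints, a single interval or two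
  intervals separated by the cut at \<pi>.\<close>

lemma measure_circle_measure_arc:
  assumes ab: "a < b" "b - a \<le> 2 * pi" and J: "{a<..<b} \<subseteq> J" "J \<subseteq> {a..b}"
  shows "measure circle_measure (cis ` J) = b - a"
proof -
  \<comment> \<open>The ceiling is chosen so that the shifted left endpoint \<open>c\<close>
    satisfies -\<pi> < c \<le> \<pi>.\<close>
  define n where "n = \<lceil>(a - pi) / (2 * pi)\<rceil>"
  define c d where "c = a - 2 * pi * of_int n" and "d = b - 2 * pi * of_int n"
  define K where "K = (\<lambda>x. x - 2 * pi * of_int n) ` J"
  have "(a - pi) / (2 * pi) \<le> of_int n" "of_int n < (a - pi) / (2 * pi) + 1"
    unfolding n_def by linarith+
  then have c: "-pi < c" "c \<le> pi" by (simp_all add: c_def field_simps)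
  have cd: "c < d" "d \<le> c + 2 * pi" "d - c = b - a" using ab by (auto simp: c_def d_def)
  have K: "{c<..<d} \<subseteq> K" "K \<subseteq> {c..d}"
  proof
    fix x assume "x \<in> {c<..<d}"
    then have "x + 2 * pi * of_int n \<in> J" using J by (auto simp: c_def d_def)
    then show "x \<in> K" unfolding K_def by (rule rev_image_eqI) simp
  qed (use J in \<open>force simp: K_def c_def d_def\<close>)
  have "cis (x - 2 * pi * of_int n) = cis x" for x
    using cis_shift[of x "-n"] by simp
  then have KJ: "cis ` J = cis ` K" by (simp add: K_def image_image)
  \<comment> \<open>Since it is not known which endpoints belong to \<open>J\<close>, the measure of
    this set is squeezed between those of unions of open and of closed intervals with the same
    endpoints.\<close>
  define T where "T = {x \<in> {-pi<..pi}. cis x \<in> cis ` K}"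
  have B: "cis ` K \<in> sets borel" using K by (rule cis_image_borel)
  have "cis \<in> measurable borel borel"
    by (intro borel_measurable_continuous_onI continuous_intros)
  from measurable_sets[OF this B] have Tb: "T \<in> sets borel"
    unfolding T_def by (simp add: vimage_def Collect_conj_eq)
  have per: "cis (x + 2 * pi) = cis x" "cis (x - 2 * pi) = cis x" for x 
    using cis_shift[of x 1] cis_shift[of x "-1"] by auto
  have inT: "x \<in> T" if "-pi < x" "x \<le> pi" "x \<in> {c<..<d} \<or> x + 2 * pi \<in> {c<..<d}" for x
  proof -
    have "x \<in> K \<or> x + 2 * pi \<in> K" using that K by blast
    then have "cis x \<in> cis ` K" using per(1)[of x] by (metis imageI)
    then show ?thesis using that by (simp add: T_def)
  qed
  have Tin: "x \<in> {c..d} \<or> x + 2 * pi \<in> {c..d}" "-pi < x" "x \<le> pi" if "x \<in> T" for x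
  proof -
    from that show x: "-pi < x" "x \<le> pi" by (auto simp: T_def)
    from that obtain y where y: "y \<in> K" "cis x = cis y" by (auto simp: T_def)
    obtain m :: int where m: "x = y + 2 * pi * of_int m" using cis_eq_cisD y by blast
    have y': "c \<le> y" "y \<le> d" using y K by auto
    then have "2 * pi * of_int m < 2 * pi * 1" "2 * pi * (-2) < 2 * pi * of_int m"
      using m x c cd by linarith+
    moreover have "0 < 2 * pi" by simp
    ultimately have "of_int m < (1::real)" "(-2::real) < of_int m"
      by (simp_all only: mult_less_cancel_left_pos)
    then have "m = 0 \<or> m = -1" by linarith
    then show "x \<in> {c..d} \<or> x + 2 * pi \<in> {c..d}" using m y' by auto
  qed
  have "emeasure lborel T = ennreal (d - c)"
  proof (cases "d \<le> pi")
    case True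
    have "{c<..<d} \<subseteq> T" using c True by (auto intro!: inT)
    then have "ennreal (d - c) \<le> emeasure lborel T"
      using emeasure_mono[of "{c<..<d}" T lborel] Tb cd by simp
    moreover have "T \<subseteq> {c..d}" using Tin True c by fastforce
    then have "emeasure lborel T \<le> ennreal (d - c)"
      using emeasure_mono[of T "{c..d}" lborel] cd by simp
    ultimately show ?thesis by (rule antisym[rotated])
  next
    case False
    have "{c<..<pi} \<union> {-pi<..<d - 2 * pi} \<subseteq> T" using c cd False by (auto intro!: inT)
    then have "emeasure lborel ({c<..<pi} \<union> {-pi<..<d - 2 * pi}) \<le> emeasure lborel T"
      using Tb by (intro emeasure_mono) auto
    moreover have "emeasure lborel ({c<..<pi} \<union> {-pi<..<d - 2 * pi})
        = emeasure lborel {c<..<pi} + emeasure lborel {-pi<..<d - 2 * pi}"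
      using cd by (intro plus_emeasure[symmetric]) auto
    moreover have "\<dots> = ennreal (d - c)"
      using c False by (simp flip: ennreal_plus)
    ultimately have 1: "ennreal (d - c) \<le> emeasure lborel T" by simp
    have "T \<subseteq> {c..pi} \<union> {-pi..d - 2 * pi}" using Tin by fastforce
    then have "emeasure lborel T \<le> emeasure lborel ({c..pi} \<union> {-pi..d - 2 * pi})"
      by (intro emeasure_mono) auto
    also have "\<dots> \<le> emeasure lborel {c..pi} + emeasure lborel {-pi..d - 2 * pi}"
      by (intro emeasure_subadditive) auto
    also have "\<dots> = ennreal (d - c)"
      using c False by (simp flip: ennreal_plus)
    finally show ?thesis using 1 by (rule antisym)
  qed
  then have "emeasure circle_measure (cis ` J) = ennreal (d - c)"
    using emeasure_circle_measure[OF B] by (simp add: KJ T_def)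
  then show ?thesis using cd by (simp add: measure_def)
qed

text \<open>A normal form with a bounded interval. An interval containing two points at distance at
  least 2 \<pi> wraps around the whole circle and is replaced by a closed one of length 2 \<pi>; any
  other is bounded and lies between its infimum and supremum.\<close>

lemma arcsE:
  assumes "I \<in> arcs"
  obtains a b J where "a < b" "b - a \<le> 2 * pi" "{a<..<b} \<subseteq> J" "J \<subseteq> {a..b}" "I = cis ` J"
proof -
  obtain J where J: "I = cis ` J" "is_interval J" "interior J \<noteq> {}"
    using assms by (auto simp: arcs_def)
  have mem: "z \<in> J" if "x \<in> J" "y \<in> J" "x \<le> z" "z \<le> y" for x y z
    using J(2) that unfolding is_interval_1 by blast
  show thesis
  proof (cases "\<exists>x\<in>J. \<exists>y\<in>J. x + 2 * pi \<le> y")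
    case True
    then obtain x y where xy: "x \<in> J" "y \<in> J" "x + 2 * pi \<le> y" by blast
    have "cis t \<in> cis ` {x..x + 2 * pi}" for t
    proof -
      define n where "n = \<lfloor>(t - x) / (2 * pi)\<rfloor>"
      have "of_int n \<le> (t - x) / (2 * pi)" "(t - x) / (2 * pi) < of_int n + 1"
        by (auto simp: n_def)
      then have "t + 2 * pi * of_int (- n) \<in> {x..x + 2 * pi}" by (simp add: field_simps)
      then show ?thesis using cis_shift[of t "-n"] by (metis imageI)
    qed
    moreover have "{x..x + 2 * pi} \<subseteq> J" using xy(3) by (auto intro!: mem[OF xy(1,2)])
    ultimately have "I = cis ` {x..x + 2 * pi}" using J(1) by blast
    then show thesis by (intro that[of x "x + 2 * pi" "{x..x + 2 * pi}"]) auto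
  next
    case False
    then have bd: "y - x \<le> 2 * pi" if "x \<in> J" "y \<in> J" for x y using that by force
    obtain x0 e where x0: "0 < e" "cball x0 e \<subseteq> J"
      using J(3) by (metis all_not_in_conv mem_interior_cball)
    have x0J: "x0 \<in> J" "x0 + e \<in> J" using x0 by (auto simp: dist_real_def)
    have bdd: "bdd_above J" "bdd_below J"
      using bd[OF x0J(1)] bd[OF _ x0J(1)]
      by (auto simp: algebra_simps intro!: bdd_aboveI[of _ "x0 + 2 * pi"] bdd_belowI[of _ "x0 - 2 * pi"])
    have "Inf J < Sup J"
      using cInf_lower[OF x0J(1) bdd(2)] cSup_upper[OF x0J(2) bdd(1)] x0 by linarith
    moreover have "Sup J - Inf J \<le> 2 * pi"
    proof -
      have "Sup J \<le> 2 * pi + Inf J"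
      proof (rule cSup_least)
        fix y assume "y \<in> J"
        then have "y - 2 * pi \<le> Inf J"
          using x0J bd by (intro cInf_greatest) (force simp: algebra_simps)+
        then show "y \<le> 2 * pi + Inf J" by simp
      qed (use x0J in auto)
      then show ?thesis by simp
    qed
    moreover have "{Inf J<..<Sup J} \<subseteq> J"
    proof
      fix z assume "z \<in> {Inf J<..<Sup J}"
      moreover have "J \<noteq> {}" using x0J by auto
      ultimately obtain x y where "x \<in> J" "x < z" "y \<in> J" "z < y"
        using bdd by (auto simp: cInf_less_iff less_cSup_iff)
      then show "z \<in> J" using mem[of x y z] by simp
    qed
    moreover have "J \<subseteq> {Inf J..Sup J}"
      using bdd by (auto intro: cInf_lower cSup_upper)
    ultimately show thesis using J(1) that by blast
  qed
qed

context
  fixes a b J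
  assumes ab: "a < b" "b - a \<le> 2 * pi" and J: "{a<..<b} \<subseteq> J" "J \<subseteq> {a..b}"
begin

lemma carleson_square_arc_eq:
  "carleson_square (cis ` J) =
     {z. z \<noteq> 0 \<and> norm z < 1 \<and> 1 - norm z < b - a \<and> (\<exists>\<phi>\<in>J. z = of_real (norm z) * cis \<phi>)}"
proof -
  have "z / of_real (norm z) \<in> cis ` J \<longleftrightarrow> (\<exists>\<phi>\<in>J. z = of_real (norm z) * cis \<phi>)" if "z \<noteq> 0" for z
    using that by (auto simp: image_iff field_simps)
  then show ?thesis
    unfolding carleson_square_def measure_circle_measure_arc[OF ab J] by auto
qed

lemma carleson_square_arc_subset: "carleson_square (cis ` J) \<subseteq> polar_box ((a + b) / 2) (b - a)"
proof
  fix z assume "z \<in> carleson_square (cis ` J)"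
  then obtain \<phi> where phi: "\<phi> \<in> J" "z = of_real (norm z) * cis \<phi>" "norm z < 1" "1 - norm z < b - a"
    by (auto simp: carleson_square_arc_eq)
  have "a \<le> \<phi>" "\<phi> \<le> b" using phi J by auto
  then have "\<bar>\<phi> - (a + b) / 2\<bar> \<le> b - a" using ab by (simp add: abs_le_iff field_simps)
  with phi show "z \<in> polar_box ((a + b) / 2) (b - a)" by (auto simp: polar_box_def)
qed

lemma carleson_square_arc_sets: "carleson_square (cis ` J) \<in> sets disc_area"
proof -
  have m: "(\<lambda>z::complex. z / of_real (norm z)) \<in> borel_measurable borel" by measurable
  have "(\<lambda>z::complex. z / of_real (norm z)) -` (cis ` J) \<in> sets borel"
    using measurable_sets[OF m cis_image_borel[OF J]] by simp
  moreover have "{z::complex. 1 - norm z < b - a} \<in> sets borel" by measurable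
  ultimately have "((\<lambda>z::complex. z / of_real (norm z)) -` (cis ` J) - {0})
      \<inter> {z::complex. 1 - norm z < b - a} \<in> sets borel" by auto
  then have "(((\<lambda>z::complex. z / of_real (norm z)) -` (cis ` J) - {0})
      \<inter> {z::complex. 1 - norm z < b - a}) \<inter> unit_disc \<in> sets disc_area" by (rule sets_disc_area_Int)
  also have "(((\<lambda>z::complex. z / of_real (norm z)) -` (cis ` J) - {0})
      \<inter> {z::complex. 1 - norm z < b - a}) \<inter> unit_disc = carleson_square (cis ` J)"
    unfolding carleson_square_def measure_circle_measure_arc[OF ab J] by auto
  finally show ?thesis .
qed

lemma emeasure_carleson_square_arc_le:
  "emeasure disc_area (carleson_square (cis ` J)) \<le> ennreal (4 * (b - a)\<^sup>2)"
proof -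
  have "carleson_square (cis ` J) \<subseteq> ball (cis ((a + b) / 2)) (2 * (b - a)) \<inter> unit_disc"
    using carleson_square_arc_subset polar_box_subset_ball by (fastforce simp: polar_box_def)
  then have "emeasure disc_area (carleson_square (cis ` J))
      \<le> emeasure disc_area (ball (cis ((a + b) / 2)) (2 * (b - a)) \<inter> unit_disc)"
    by (intro emeasure_mono) auto
  also have "\<dots> \<le> ennreal ((2 * (b - a))\<^sup>2)"
    using ab by (intro emeasure_disc_area_ball_le) auto
  also have "(2 * (b - a))\<^sup>2 = 4 * (b - a)\<^sup>2" by (subst power_mult_distrib) simp
  finally show ?thesis .
qed

text \<open>The square contains a ball of radius l / 16 about the point at depth l / 2 in its
  angular middle. Capping l at 1 keeps that centre at modulus at least 1/2, so that
  \<open>polar_near\<close> controls the angle within l / 4.\<close>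

lemma emeasure_carleson_square_arc_ge:
  "ennreal (((b - a) / 112)\<^sup>2) \<le> emeasure disc_area (carleson_square (cis ` J))"
proof -
  define \<theta> l where "\<theta> = (a + b) / 2" and "l = min 1 (b - a)"
  define c where "c = of_real (1 - l / 2) * cis \<theta>"
  have l: "0 < l" "l \<le> 1" "l \<le> b - a" using ab by (auto simp: l_def)
  have nc: "norm c = 1 - l / 2"
    using l by (simp add: c_def norm_mult del: of_real_diff)
  have sub: "ball c (l / 16) \<subseteq> carleson_square (cis ` J)"
  proof
    fix z assume "z \<in> ball c (l / 16)"
    then have z: "norm (z - c) < l / 16" by (simp add: dist_norm norm_minus_commute)
    have n: "\<bar>norm z - norm c\<bar> < l / 16" using norm_triangle_ineq3[of z c] z by linarith
    have "l / 8 * (1 / 2) \<le> l / 8 * norm c" using l by (intro mult_left_mono) (auto simp: nc)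
    then have "norm (z - c) \<le> l / 8 * norm c" using z by linarith
    moreover have "c \<noteq> 0" "c = of_real (norm c) * cis \<theta>" using nc l by (auto simp: c_def)
    ultimately obtain \<phi> where phi: "\<bar>\<phi> - \<theta>\<bar> \<le> 2 * (l / 8)" "z = of_real (norm z) * cis \<phi>" "z \<noteq> 0"
      using polar_near[of c \<theta> z "l / 8"] l by auto
    have "\<bar>\<phi> - (a + b) / 2\<bar> \<le> l / 4" using phi(1) by (simp add: \<theta>_def)
    then have "\<phi> - (a + b) / 2 \<le> l / 4" "- (\<phi> - (a + b) / 2) \<le> l / 4"
      by (rule abs_le_D1, rule abs_le_D2)
    then have "a < \<phi>" "\<phi> < b" using l by (simp_all add: field_simps)
    then have "\<phi> \<in> {a<..<b}" by simp
    moreover have "norm z < 1" "1 - norm z < b - a"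
      using abs_le_D1[OF less_imp_le[OF n]] abs_le_D2[OF less_imp_le[OF n]] l unfolding nc by linarith+
    ultimately show "z \<in> carleson_square (cis ` J)"
      unfolding carleson_square_arc_eq using phi J by blast
  qed
  \<comment> \<open>The length of the arc is at most 2 \<pi> < 7 = 112 / 16, which compensates for
    capping l at 1.\<close>
  have "(b - a) / 112 \<le> l / 16"
    using ab pi_less_4 pi_approx by (auto simp: l_def min_def)
  then have "((b - a) / 112)\<^sup>2 \<le> (l / 16)\<^sup>2" using ab by (intro power_mono) auto
  then have "ennreal (((b - a) / 112)\<^sup>2) \<le> ennreal ((l / 16)\<^sup>2)" by (rule ennreal_leI)
  also have "\<dots> = emeasure disc_area (ball c (l / 16))"
    using l sub by (subst emeasure_disc_area_ball) (auto simp: carleson_square_def)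
  also have "\<dots> \<le> emeasure disc_area (carleson_square (cis ` J))"
    using sub by (intro emeasure_mono carleson_square_arc_sets)
  finally show ?thesis .
qed

end

section \<open>Weights whose logarithm is hyperbolically Lipschitz\<close>

lemma one_divide_ennreal_le:
  assumes "0 < x" "ennreal x \<le> E"
  shows "1 / E \<le> ennreal (1 / x)"
proof (cases E)
  case (real e)
  then have "x \<le> e" using assms by (simp add: ennreal_le_iff)
  moreover have "1 / E = ennreal (1 / e)"
    using real assms \<open>x \<le> e\<close> by (simp add: divide_ennreal flip: ennreal_1)
  ultimately show ?thesis using assms by (simp add: ennreal_leI frac_le)
qed simp

text \<open>The existential quantifier over the angle describes the image of a compact rectangle
  under polar coordinates, which is compact.\<close>

lemma polar_box_sets: "polar_box \<theta> l \<in> sets disc_area"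
proof -
  define S where "S = (\<lambda>(\<rho>, \<phi>). of_real \<rho> * cis \<phi>) ` ({0..1} \<times> {\<theta> - l..\<theta> + l})"
  have "compact S"
    unfolding S_def case_prod_beta
    by (intro compact_continuous_image continuous_intros compact_Times) auto
  then have "S \<in> sets borel" by (rule borel_compact)
  moreover have "{z::complex. 1 - norm z < l} \<in> sets borel" by measurable
  ultimately have "S \<inter> {z. 1 - norm z < l} \<in> sets borel" by auto
  then have "(S \<inter> {z. 1 - norm z < l}) \<inter> unit_disc \<in> sets disc_area" by (rule sets_disc_area_Int)
  also have "(S \<inter> {z. 1 - norm z < l}) \<inter> unit_disc = polar_box \<theta> l"
  proof (intro equalityI subsetI)
    fix z assume z: "z \<in> (S \<inter> {z. 1 - norm z < l}) \<inter> unit_disc"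
    then obtain \<rho> \<phi> where p: "0 \<le> \<rho>" "\<theta> - l \<le> \<phi>" "\<phi> \<le> \<theta> + l" "z = of_real \<rho> * cis \<phi>"
      by (auto simp: S_def)
    then have "z = of_real (norm z) * cis \<phi>" by (simp add: norm_mult)
    moreover have "\<bar>\<phi> - \<theta>\<bar> \<le> l" using p by (simp add: abs_le_iff)
    ultimately show "z \<in> polar_box \<theta> l" using z by (auto simp: polar_box_def)
  next
    fix z assume z: "z \<in> polar_box \<theta> l"
    then obtain \<phi> where p: "\<bar>\<phi> - \<theta>\<bar> \<le> l" "z = of_real (norm z) * cis \<phi>" by (auto simp: polar_box_def)
    have "(norm z, \<phi>) \<in> {0..1} \<times> {\<theta> - l..\<theta> + l}"
      using p(1) z by (auto simp: polar_box_def abs_le_iff)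
    then have "z \<in> S" using p(2) unfolding S_def by (intro image_eqI[where x = "(norm z, \<phi>)"]) simp_all
    then show "z \<in> (S \<inter> {z. 1 - norm z < l}) \<inter> unit_disc" using z by (auto simp: polar_box_def)
  qed
  finally show ?thesis .
qed

text \<open>The sum of the dyadic series in \<open>nn_integral_polar_box_le\<close>, without the
  factor l^2.\<close>

definition box_const :: "real \<Rightarrow> real" where
  "box_const s = 4 * 2 powr s / (1 - 2 powr s / 2)"

lemma box_const_pos:
  assumes "0 \<le> s" "s < 1"
  shows "0 < box_const s"
  using assms powr_less_mono[of s 1 2] by (simp add: box_const_def)

lemma borel_measurable_disc_area: "F \<in> borel_measurable borel \<Longrightarrow> F \<in> borel_measurable disc_area"
  unfolding disc_area_def
  by (simp add: measurable_cong_sets[OF sets_scale_measure refl] measurable_restrict_space1 measurable_completion)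

lemma nn_integral_polar_box_cmult_le:
  assumes s: "0 \<le> s" "s < 1" and l: "0 < l" and c: "0 \<le> c"
  shows "(\<integral>\<^sup>+z\<in>polar_box \<theta> l. ennreal (c * (l / (1 - norm z)) powr s) \<partial>disc_area)
    \<le> ennreal (c * box_const s * l\<^sup>2)"
proof -
  have [measurable]: "(\<lambda>z. ennreal ((l / (1 - norm z)) powr s)) \<in> borel_measurable disc_area"
    by (intro measurable_compose[OF borel_measurable_disc_area measurable_ennreal]) measurable
  note polar_box_sets[measurable]
  have "(\<integral>\<^sup>+z\<in>polar_box \<theta> l. ennreal (c * (l / (1 - norm z)) powr s) \<partial>disc_area)
      = (\<integral>\<^sup>+z. ennreal c * (ennreal ((l / (1 - norm z)) powr s) * indicator (polar_box \<theta> l) z) \<partial>disc_area)"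
    using c by (simp add: ennreal_mult mult.assoc)
  also have "\<dots> = ennreal c * (\<integral>\<^sup>+z\<in>polar_box \<theta> l. ennreal ((l / (1 - norm z)) powr s) \<partial>disc_area)"
    by (intro nn_integral_cmult) measurable
  also have "\<dots> \<le> ennreal c * ennreal (box_const s * l\<^sup>2)"
    unfolding box_const_def using nn_integral_polar_box_le[OF s l] by (intro mult_left_mono) auto
  also have "\<dots> = ennreal (c * box_const s * l\<^sup>2)"
    using c box_const_pos[OF s] by (simp add: ennreal_mult mult.assoc)
  finally show ?thesis .
qed

text \<open>The reference point of a box: at depth l above the middle angle, or the origin once l
  \<ge> 1.\<close>

definition box_top :: "real \<Rightarrow> real \<Rightarrow> complex" where
  "box_top \<theta> l = of_real (1 - min 1 l) * cis \<theta>"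

lemma norm_box_top: "0 < l \<Longrightarrow> norm (box_top \<theta> l) = 1 - min 1 l"
  by (simp add: box_top_def norm_mult del: of_real_diff)

lemma norm_box_top_less_1: "0 < l \<Longrightarrow> norm (box_top \<theta> l) < 1"
  by (simp add: norm_box_top)

text \<open>The top w has depth min 1 l, and |1 - cnj z * w| \<le> 3 min 1 l. In
  \<open>hyp_dist_le\<close> this gives the constant 4 * 9 = 36, and one factor min 1 l cancels
  against 1 - |w|.\<close>

lemma hyp_dist_box_top_le:
  assumes l: "0 < l" and z: "z \<in> polar_box \<theta> l"
  shows "hyp_dist z (box_top \<theta> l) \<le> 1 / 2 * ln (36 * (l / (1 - norm z)))"
proof -
  obtain \<phi> where phi: "norm z < 1" "1 - norm z < l" "\<bar>\<phi> - \<theta>\<bar> \<le> l" "z = of_real (norm z) * cis \<phi>"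
    using z by (auto simp: polar_box_def)
  define w where "w = box_top \<theta> l"
  have w: "norm w = 1 - min 1 l" "norm w < 1"
    using l by (simp_all add: w_def norm_box_top)
  have "norm (1 - cnj z * w) \<le> 3 * min 1 l"
  proof (cases "1 \<le> l")
    case True
    then show ?thesis by (simp add: w_def box_top_def)
  next
    case False
    \<comment> \<open>The product cnj z * w has modulus x with 1 - x \<le> 2 l and an argument of
      size at most l, so its distance from 1 is at most 3 l.\<close>
    define x where "x = norm z * (1 - l)"
    have x: "0 \<le> x" "x \<le> 1" using phi(1) False l by (auto simp: x_def mult_le_one)
    have "cnj z * w = of_real x * cis (\<theta> - \<phi>)"
    proof -
      have "cnj z = of_real (norm z) * cis (- \<phi>)"
        by (subst phi(4)) (simp add: cis_cnj)
      then show ?thesis using False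
        by (simp add: w_def box_top_def x_def diff_conv_add_uminus cis_mult[symmetric] mult_ac
            del: of_real_diff add_uminus_conv_diff)
    qed
    then have "1 - cnj z * w = of_real (1 - x) + of_real x * (cis 0 - cis (\<theta> - \<phi>))"
      by (simp add: algebra_simps)
    then have "norm (1 - cnj z * w) \<le> \<bar>1 - x\<bar> + \<bar>x\<bar> * norm (cis 0 - cis (\<theta> - \<phi>))"
      using norm_triangle_ineq[of "of_real (1 - x)" "of_real x * (cis 0 - cis (\<theta> - \<phi>))"]
      by (simp add: norm_mult del: of_real_diff cis_zero)
    also have "\<dots> \<le> (1 - x) + 1 * \<bar>\<theta> - \<phi>\<bar>"
      using x norm_cis_diff_le[of 0 "\<theta> - \<phi>"] by (intro add_mono mult_mono) auto
    also have "\<dots> \<le> 2 * l + l"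
    proof -
      have "1 - x = (1 - norm z) + norm z * l" by (simp add: x_def algebra_simps)
      moreover have "norm z * l \<le> l" using phi(1) l by (simp add: mult_left_le_one_le)
      ultimately have "1 - x \<le> 2 * l" using phi(2) by linarith
      moreover have "\<bar>\<theta> - \<phi>\<bar> \<le> l" using phi(3) by (simp add: abs_minus_commute)
      ultimately show ?thesis by simp
    qed
    finally show ?thesis using False by simp
  qed
  then have d: "(norm (1 - cnj z * w))\<^sup>2 \<le> (3 * min 1 l)\<^sup>2" by (intro power_mono) auto
  have "4 * (norm (1 - cnj z * w))\<^sup>2 / ((1 - norm z) * (1 - norm w))
      \<le> 4 * (3 * min 1 l)\<^sup>2 / ((1 - norm z) * (1 - norm w))"
    using d phi(1) w by (intro divide_right_mono mult_left_mono) auto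
  also have "\<dots> = 36 * (min 1 l / (1 - norm z))"
    using w l by (simp add: power2_eq_square)
  also have "\<dots> \<le> 36 * (l / (1 - norm z))"
    using phi(1) by (intro mult_left_mono divide_right_mono) auto
  finally have "4 * (norm (1 - cnj z * w))\<^sup>2 / ((1 - norm z) * (1 - norm w)) \<le> 36 * (l / (1 - norm z))" .
  moreover have "0 < 4 * (norm (1 - cnj z * w))\<^sup>2 / ((1 - norm z) * (1 - norm w))"
    using phi(1) w one_minus_cnj_mult_pos[of z w] by (intro divide_pos_pos mult_pos_pos) auto
  ultimately have "1 / 2 * ln (4 * (norm (1 - cnj z * w))\<^sup>2 / ((1 - norm z) * (1 - norm w)))
      \<le> 1 / 2 * ln (36 * (l / (1 - norm z)))" by simp
  then show ?thesis using hyp_dist_le[of z w] phi(1) w by (simp add: w_def)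
qed

text \<open>The distance to the top is at most half a logarithm of 36 l / (1 - |z|), so the
  exponential is bounded by a multiple of (l / (1 - |z|))^(\<kappa>/2). The threshold \<kappa> < 2
  is the condition that this exponent be less than 1.\<close>

lemma nn_integral_exp_polar_box_le:
  assumes l: "0 < l" and lam: "0 \<le> \<kappa>" "\<kappa> < 2"
    and q: "AE z in disc_area. q z \<le> M + \<kappa> * hyp_dist z (box_top \<theta> l)"
  shows "(\<integral>\<^sup>+z\<in>polar_box \<theta> l. ennreal (exp (q z)) \<partial>disc_area)
    \<le> ennreal (exp M * 36 powr (\<kappa> / 2) * box_const (\<kappa> / 2) * l\<^sup>2)"
proof -
  have "(\<integral>\<^sup>+z\<in>polar_box \<theta> l. ennreal (exp (q z)) \<partial>disc_area)
      \<le> (\<integral>\<^sup>+z\<in>polar_box \<theta> l. ennreal (exp M * 36 powr (\<kappa> / 2) * (l / (1 - norm z)) powr (\<kappa> / 2)) \<partial>disc_area)"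
  proof (intro nn_integral_mono_AE, use q in eventually_elim)
    case (elim z)
    show ?case
    proof (cases "z \<in> polar_box \<theta> l")
      case True
      define x where "x = l / (1 - norm z)"
      have x: "0 < x" using True l by (auto simp: x_def polar_box_def)
      have "q z \<le> M + \<kappa> * (1 / 2 * ln (36 * x))"
        using elim hyp_dist_box_top_le[OF l True] lam mult_left_mono[of _ _ \<kappa>]
        unfolding x_def by (smt (verit))
      then have "exp (q z) \<le> exp M * exp (\<kappa> / 2 * ln (36 * x))"
        by (simp flip: exp_add)
      also have "exp (\<kappa> / 2 * ln (36 * x)) = 36 powr (\<kappa> / 2) * x powr (\<kappa> / 2)"
        using x by (simp add: powr_def ln_mult exp_add[symmetric] algebra_simps)
      finally have "exp (q z) \<le> exp M * 36 powr (\<kappa> / 2) * x powr (\<kappa> / 2)" by (simp add: mult_ac)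
      with True show ?thesis by (simp add: x_def ennreal_leI)
    qed simp
  qed
  also have "\<dots> \<le> ennreal (exp M * 36 powr (\<kappa> / 2) * box_const (\<kappa> / 2) * l\<^sup>2)"
    using lam l by (intro nn_integral_polar_box_cmult_le) auto
  finally show ?thesis .
qed

text \<open>Over each box, e^q and e^(-q) have integrals at most a constant times l^2 e^(u(top)) and
  l^2 e^(-u(top)). Carleson squares have area at least (l / 112)^2, so these are bounds for
  averages. Integrability of the weight is the case of a box of size 4, which contains the
  disc.\<close>

lemma B2_weight_exp_of_hyp_lipschitz:
  fixes q u :: "complex \<Rightarrow> real"
  assumes q: "q \<in> borel_measurable disc_area"
    and lam: "0 \<le> \<kappa>" "\<kappa> < 2"
    and u: "\<And>z w. norm z < 1 \<Longrightarrow> norm w < 1 \<Longrightarrow> \<bar>u z - u w\<bar> \<le> \<kappa> * hyp_dist z w"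
    and M: "AE z in disc_area. \<bar>q z - u z\<bar> \<le> M"
  shows "B2_weight (\<lambda>z. exp (q z))"
proof -
  define K where "K = exp M * 36 powr (\<kappa> / 2) * box_const (\<kappa> / 2)"
  have K: "0 \<le> K" using lam box_const_pos[of "\<kappa> / 2"] by (simp add: K_def)
  have AE1: "AE z in disc_area. q z - u w \<le> M + \<kappa> * hyp_dist z w"
    "AE z in disc_area. - q z + u w \<le> M + \<kappa> * hyp_dist z w" if "norm w < 1" for w
    using M AE_space[of disc_area]
    by (eventually_elim, use u[OF _ that] in \<open>fastforce simp: abs_le_iff\<close>)+
  have bound: "(\<integral>\<^sup>+z\<in>polar_box \<theta> l. ennreal (exp (q z)) \<partial>disc_area)
        \<le> ennreal (exp (u (box_top \<theta> l)) * K * l\<^sup>2)"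
      "(\<integral>\<^sup>+z\<in>polar_box \<theta> l. ennreal (inverse (exp (q z))) \<partial>disc_area)
        \<le> ennreal (exp (- u (box_top \<theta> l)) * K * l\<^sup>2)" if l: "0 < l" for \<theta> l
  proof -
    have w: "norm (box_top \<theta> l) < 1" using l by (rule norm_box_top_less_1)
    have "AE z in disc_area. q z \<le> (u (box_top \<theta> l) + M) + \<kappa> * hyp_dist z (box_top \<theta> l)"
      using AE1(1)[OF w] by eventually_elim simp
    from nn_integral_exp_polar_box_le[OF l lam this]
    show "(\<integral>\<^sup>+z\<in>polar_box \<theta> l. ennreal (exp (q z)) \<partial>disc_area)
        \<le> ennreal (exp (u (box_top \<theta> l)) * K * l\<^sup>2)" by (simp add: K_def exp_add mult.assoc)
    have "AE z in disc_area. - q z \<le> (- u (box_top \<theta> l) + M) + \<kappa> * hyp_dist z (box_top \<theta> l)"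
      using AE1(2)[OF w] by eventually_elim simp
    from nn_integral_exp_polar_box_le[OF l lam this]
    show "(\<integral>\<^sup>+z\<in>polar_box \<theta> l. ennreal (inverse (exp (q z))) \<partial>disc_area)
        \<le> ennreal (exp (- u (box_top \<theta> l)) * K * l\<^sup>2)"
      by (simp only: K_def exp_add exp_minus[symmetric] mult.assoc)
  qed
  have "weight (\<lambda>z. exp (q z))"
    unfolding weight_def
  proof (intro conjI ballI integrableI_nonneg)
    show "(\<lambda>z. exp (q z)) \<in> borel_measurable disc_area" using q by measurable
    have "(\<integral>\<^sup>+z. ennreal (exp (q z)) \<partial>disc_area)
        = (\<integral>\<^sup>+z\<in>polar_box 0 4. ennreal (exp (q z)) \<partial>disc_area)"
      using subsetD[OF unit_disc_subset_polar_box[of 0]]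
      by (intro nn_integral_cong) (simp add: indicator_def)
    also have "\<dots> < \<infinity>"
      using bound(1)[of 4 0] by (simp add: le_less_trans[OF _ ennreal_less_top])
    finally show "(\<integral>\<^sup>+z. ennreal (exp (q z)) \<partial>disc_area) < \<infinity>" .
  qed auto
  moreover have "B2_const_sq (\<lambda>z. exp (q z)) \<le> ennreal ((K * 112\<^sup>2)\<^sup>2)"
    unfolding B2_const_sq_def
  proof (rule SUP_least)
    fix I assume "I \<in> arcs"
    then obtain a b J where ab: "a < b" "b - a \<le> 2 * pi" and J: "{a<..<b} \<subseteq> J" "J \<subseteq> {a..b}"
      and I: "I = cis ` J" by (rule arcsE)
    define l \<theta> where "l = b - a" and "\<theta> = (a + b) / 2"
    define E where "E = emeasure disc_area (carleson_square I)"
    define U where "U = u (box_top \<theta> l)"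
    have l: "0 < l" using ab by (simp add: l_def)
    have sub: "carleson_square I \<subseteq> polar_box \<theta> l"
      unfolding I l_def \<theta>_def by (rule carleson_square_arc_subset[OF ab J])
    have "ennreal ((l / 112)\<^sup>2) \<le> E"
      unfolding I l_def E_def by (rule emeasure_carleson_square_arc_ge[OF ab J])
    then have E: "1 / E \<le> ennreal (112\<^sup>2 / l\<^sup>2)"
      using one_divide_ennreal_le[of "(l / 112)\<^sup>2" E] l by (simp add: power_divide)
    have avg: "1 / E * (\<integral>\<^sup>+z\<in>carleson_square I. p z \<partial>disc_area) \<le> ennreal (exp c * (K * 112\<^sup>2))"
      if "(\<integral>\<^sup>+z\<in>polar_box \<theta> l. p z \<partial>disc_area) \<le> ennreal (exp c * K * l\<^sup>2)" for p c
    proof -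
      have "(\<integral>\<^sup>+z\<in>carleson_square I. p z \<partial>disc_area) \<le> (\<integral>\<^sup>+z\<in>polar_box \<theta> l. p z \<partial>disc_area)"
        using sub by (intro nn_integral_mono) (auto simp: indicator_def)
      then have "1 / E * (\<integral>\<^sup>+z\<in>carleson_square I. p z \<partial>disc_area)
          \<le> ennreal (112\<^sup>2 / l\<^sup>2) * ennreal (exp c * K * l\<^sup>2)"
        using E that by (intro mult_mono order_trans[OF _ that]) auto
      also have "\<dots> = ennreal (exp c * (K * 112\<^sup>2))"
        using l K by (simp add: field_simps flip: ennreal_mult)
      finally show ?thesis .
    qed
    have "(1 / E * (\<integral>\<^sup>+z\<in>carleson_square I. ennreal (exp (q z)) \<partial>disc_area)) *
        (1 / E * (\<integral>\<^sup>+z\<in>carleson_square I. ennreal (inverse (exp (q z))) \<partial>disc_area))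
      \<le> ennreal (exp U * (K * 112\<^sup>2)) * ennreal (exp (- U) * (K * 112\<^sup>2))"
      unfolding U_def by (intro mult_mono avg bound l) auto
    also have "\<dots> = ennreal (exp U * (K * 112\<^sup>2) * (exp (- U) * (K * 112\<^sup>2)))"
      using K by (simp flip: ennreal_mult)
    \<comment> \<open>The values of \<open>u\<close> at the top cancel, so the bound is the same for
      all arcs.\<close>
    also have "exp U * (K * 112\<^sup>2) * (exp (- U) * (K * 112\<^sup>2)) = (K * 112\<^sup>2)\<^sup>2"
      by (simp add: exp_minus power2_eq_square)
    finally show "1 / emeasure disc_area (carleson_square I) *
        (\<integral>\<^sup>+z\<in>carleson_square I. ennreal (exp (q z)) \<partial>disc_area) *
        (1 / emeasure disc_area (carleson_square I) *
        (\<integral>\<^sup>+z\<in>carleson_square I. ennreal (inverse (exp (q z))) \<partial>disc_area))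
      \<le> ennreal ((K * 112\<^sup>2)\<^sup>2)"
      by (simp add: E_def)
  qed
  ultimately show ?thesis
    unfolding B2_weight_def by (simp add: le_less_trans[OF _ ennreal_less_top])
qed

section \<open>Large-scale Lipschitz functions\<close>

lemma HLip_norm_leI:
  assumes "\<And>z w. norm z < 1 \<Longrightarrow> norm w < 1 \<Longrightarrow> \<bar>v z - v w\<bar> \<le> L * hyp_dist z w"
  shows "HLip_norm v \<le> ennreal L"
  unfolding HLip_norm_def
  by (rule SUP_least) (auto intro!: ennreal_leI simp: pos_divide_le_eq hyp_dist_pos assms)

lemma HLip_norm_leD:
  assumes "HLip_norm v \<le> ennreal L" "0 \<le> L" "norm z < 1" "norm w < 1"
  shows "\<bar>v z - v w\<bar> \<le> L * hyp_dist z w"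
proof (cases "z = w")
  case False
  have "ennreal (\<bar>v z - v w\<bar> / hyp_dist z w) \<le> HLip_norm v"
    unfolding HLip_norm_def using assms False by (intro SUP_upper2[of "(z, w)"]) auto
  also note assms(1)
  finally have "\<bar>v z - v w\<bar> / hyp_dist z w \<le> L" using assms(2) by (simp add: ennreal_le_iff)
  then show ?thesis using hyp_dist_pos[OF assms(3,4) False] by (simp add: pos_divide_le_eq)
qed (use assms hyp_dist_nonneg in auto)

lemma continuous_on_hyp_dist:
  assumes "norm z < 1"
  shows "continuous_on unit_disc (\<lambda>w. hyp_dist w z)"
proof -
  have 1: "1 - cnj w * z \<noteq> 0" if "norm w < 1" for w
    using one_minus_cnj_mult_pos[OF that assms] by auto
  have 2: "1 - norm ((w - z) / (1 - cnj w * z)) > 0" if "norm w < 1" for w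
    using norm_disc_phi_less_1[OF that assms] by (simp add: disc_phi_def)
  have 3: "(1 + norm ((w - z) / (1 - cnj w * z))) / (1 - norm ((w - z) / (1 - cnj w * z))) > 0"
    if "norm w < 1" for w
    using 2[OF that] by (intro divide_pos_pos add_pos_nonneg) auto
  show ?thesis
    unfolding hyp_dist_def disc_phi_def
    by (intro continuous_intros ballI) (use 1 2 3 in \<open>force+\<close>)
qed

lemma continuous_on_of_hyp_lipschitz:
  fixes g :: "complex \<Rightarrow> real"
  assumes g: "\<And>z w. norm z < 1 \<Longrightarrow> norm w < 1 \<Longrightarrow> \<bar>g z - g w\<bar> \<le> L * hyp_dist z w"
  shows "continuous_on unit_disc g"
  unfolding continuous_on_def
proof
  fix z assume z: "z \<in> unit_disc"
  then have "((\<lambda>w. hyp_dist w z) \<longlongrightarrow> hyp_dist z z) (at z within unit_disc)"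
    using continuous_on_hyp_dist[of z] by (simp add: continuous_on_def)
  then have "((\<lambda>w. L * hyp_dist w z) \<longlongrightarrow> L * hyp_dist z z) (at z within unit_disc)"
    by (intro tendsto_intros)
  then have lim: "((\<lambda>w. L * hyp_dist w z) \<longlongrightarrow> 0) (at z within unit_disc)"
    by (simp add: hyp_dist_def disc_phi_def)
  have "((\<lambda>w. g w - g z) \<longlongrightarrow> 0) (at z within unit_disc)"
  proof (rule Lim_null_comparison[OF _ lim])
    show "\<forall>\<^sub>F w in at z within unit_disc. norm (g w - g z) \<le> L * hyp_dist w z"
      unfolding eventually_at_filter using z g by (intro always_eventually) auto
  qed
  then show "(g \<longlongrightarrow> g z) (at z within unit_disc)" by (simp add: Lim_null[symmetric] LIM_zero_iff)
qed

text \<open>Measurability is obtained through continuity; this serves the inf-convolution below,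
  which is an infimum over uncountably many points.\<close>

lemma borel_measurable_of_hyp_lipschitz:
  fixes g :: "complex \<Rightarrow> real"
  assumes "\<And>z w. norm z < 1 \<Longrightarrow> norm w < 1 \<Longrightarrow> \<bar>g z - g w\<bar> \<le> L * hyp_dist z w"
  shows "g \<in> borel_measurable disc_area"
proof -
  have "continuous_on unit_disc g" by (rule continuous_on_of_hyp_lipschitz[OF assms])
  then have "g \<in> borel_measurable (lebesgue_on unit_disc)"
    by (intro continuous_imp_measurable_on_sets_lebesgue) auto
  then show ?thesis
    by (simp add: disc_area_def measurable_cong_sets[OF sets_scale_measure refl])
qed

text \<open>The inf-convolution g satisfies f - C \<le> g \<le> f, so h = f - g is bounded; the
  triangle inequality for \<beta> makes g Lipschitz with constant exactly \<open>L\<close>.\<close>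

lemma quasi_lipschitz_regularization:
  fixes f :: "complex \<Rightarrow> real"
  assumes f: "f \<in> borel_measurable disc_area" and L: "0 \<le> L"
    and osc: "\<And>z w. norm z < 1 \<Longrightarrow> norm w < 1 \<Longrightarrow> \<bar>f z - f w\<bar> \<le> L * hyp_dist z w + C"
  shows "\<exists>h\<in>Linfty_disc. HLip_norm (\<lambda>z. f z - h z) \<le> ennreal L"
proof -
  define g where "g = (\<lambda>z. INF w\<in>unit_disc. f w + L * hyp_dist z w)"
  have bdd: "bdd_below ((\<lambda>w. f w + L * hyp_dist z w) ` unit_disc)" if "norm z < 1" for z
    using osc[OF that] by (intro bdd_belowI2[of _ "f z - C"]) (fastforce dest: abs_le_D1)
  have ne: "unit_disc \<noteq> {}" by simp
  have gle: "g z \<le> f w + L * hyp_dist z w" if "norm z < 1" "norm w < 1" for z w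
    unfolding g_def using bdd[OF that(1)] that(2) by (intro cINF_lower) auto
  have gge: "f z - C \<le> g z" if "norm z < 1" for z
    unfolding g_def using osc[OF that] by (intro cINF_greatest ne) (fastforce dest: abs_le_D1)
  have lip1: "g z \<le> g z' + L * hyp_dist z z'" if "norm z < 1" "norm z' < 1" for z z'
  proof -
    have "g z - L * hyp_dist z z' \<le> g z'"
      unfolding g_def[THEN fun_cong, of z']
    proof (intro cINF_greatest ne)
      fix w :: complex assume w: "w \<in> unit_disc"
      have "L * hyp_dist z w \<le> L * (hyp_dist z z' + hyp_dist z' w)"
        using w that L by (intro mult_left_mono hyp_dist_triangle) auto
      then show "g z - L * hyp_dist z z' \<le> f w + L * hyp_dist z' w"
        using gle[of z w] w that by (simp add: algebra_simps)
    qed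
    then show ?thesis by simp
  qed
  have lip: "\<bar>g z - g w\<bar> \<le> L * hyp_dist z w" if "norm z < 1" "norm w < 1" for z w
    using lip1[OF that] lip1[OF that(2,1)] hyp_dist_commute[of z w] by (simp add: abs_le_iff)
  define h where "h = (\<lambda>z. f z - g z)"
  have "0 \<le> h z \<and> h z \<le> C" if "norm z < 1" for z
    using gle[OF that that] gge[OF that] by (simp add: h_def hyp_dist_def disc_phi_def)
  then have "AE z in disc_area. \<bar>h z\<bar> \<le> C"
    by (intro AE_I2) auto
  moreover have "h \<in> borel_measurable disc_area"
    unfolding h_def using f borel_measurable_of_hyp_lipschitz[OF lip] by (intro borel_measurable_diff)
  ultimately have "h \<in> Linfty_disc" by (auto simp: Linfty_disc_def)
  moreover have "HLip_norm (\<lambda>z. f z - h z) \<le> ennreal L"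
    using lip by (intro HLip_norm_leI) (simp add: h_def)
  ultimately show ?thesis by blast
qed

section \<open>From the B2 condition to a quasi-Lipschitz estimate\<close>

lemma emeasure_disc_area_ball_minus_0:
  assumes "0 \<le> r" "ball c r \<subseteq> unit_disc"
  shows "emeasure disc_area (ball c r - {0}) = ennreal (r\<^sup>2)"
proof -
  have "emeasure disc_area (ball c r - {0}) = ennreal (1 / pi) * emeasure lborel (ball c r - {0})"
    using assms by (intro emeasure_disc_area) auto
  also have "emeasure lborel (ball c r - {0}) = emeasure lborel (ball c r)"
    by (intro emeasure_Diff_null_set) auto
  also have "ennreal (1 / pi) * emeasure lborel (ball c r) = emeasure disc_area (ball c r)"
    using assms by (simp add: emeasure_disc_area)
  finally show ?thesis using emeasure_disc_area_ball[OF assms] by simp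
qed

text \<open>The depths of z and w and the distance |z - w| are all at most d, so an arc of length 10
  d around the argument of z serves both points. For d \<ge> 1/5 the full circle is taken instead,
  since the area of the disc is 1 \<le> 400 d^2.\<close>

lemma carleson_square_joining:
  assumes z: "norm z < 1" and w: "norm w < 1" and d: "d = norm (1 - cnj z * w)"
  obtains I where "I \<in> arcs" "carleson_square I \<in> sets disc_area"
    "emeasure disc_area (carleson_square I) \<le> ennreal (400 * d\<^sup>2)"
    "\<And>x. x \<noteq> 0 \<Longrightarrow> norm (x - z) < (1 - norm z) / 4 \<or> norm (x - w) < (1 - norm w) / 4
      \<Longrightarrow> x \<in> carleson_square I"
proof -
  have dz: "1 - norm z \<le> d" and dw: "1 - norm w \<le> d"
    using norm_one_minus_cnj_mult_ge[of w z] norm_one_minus_cnj_mult_ge[of z w] z w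
    by (simp_all add: d norm_one_minus_cnj_mult_commute[of z w])
  have d0: "0 < d" using dz z by linarith
  have xlt: "norm x < 1" if "norm (x - z) < (1 - norm z) / 4 \<or> norm (x - w) < (1 - norm w) / 4" for x
    using that hyp_dist_le_1(1)[OF z, of x] hyp_dist_le_1(1)[OF w, of x] z w by auto
  have arc: "cis ` {a..b} \<in> arcs" if "a < b" for a b
    unfolding arcs_def using that by (auto intro!: exI[of _ "{a..b}"] simp: is_interval_cc)
  show thesis
  proof (cases "d < 1 / 5")
    case False
    define I where "I = cis ` {-pi..pi}"
    have ab: "-pi < pi" "pi - -pi \<le> 2 * pi" "{-pi<..<pi} \<subseteq> {-pi..pi}" "{-pi..pi} \<subseteq> {-pi..pi}" by auto
    have "emeasure disc_area (carleson_square I) \<le> emeasure disc_area unit_disc"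
      using emeasure_space[of disc_area "carleson_square I"] by simp
    also have "\<dots> = 1" using emeasure_disc_area_ball[of 1 0] by simp
    also have "1 \<le> ennreal (400 * d\<^sup>2)"
    proof -
      have "(1 / 5)\<^sup>2 \<le> d\<^sup>2" using False by (intro power_mono) auto
      then show ?thesis by (simp add: power2_eq_square)
    qed
    finally have E: "emeasure disc_area (carleson_square I) \<le> ennreal (400 * d\<^sup>2)" .
    have "x \<in> carleson_square I" if "x \<noteq> 0" "norm x < 1" for x
    proof -
      have "x = of_real (norm x) * cis (Arg x)" using rcis_cmod_Arg[of x] by (simp add: rcis_def)
      moreover have "Arg x \<in> {-pi..pi}" using Arg_bounded[of x] by simp
      moreover have "1 - norm x < pi - -pi" using pi_gt3 norm_ge_zero[of x] by linarith
      ultimately show ?thesis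
        unfolding I_def carleson_square_arc_eq[OF ab] using that by blast
    qed
    then show thesis
      using that[of I] E xlt arc[of "-pi" pi] carleson_square_arc_sets[OF ab] unfolding I_def by auto
  next
    case True
    define \<theta> where "\<theta> = Arg z"
    have nz: "4 / 5 < norm z" using dz True by linarith
    then have z0: "z \<noteq> 0" by auto
    have zc: "z = of_real (norm z) * cis \<theta>" using rcis_cmod_Arg[of z] by (simp add: rcis_def \<theta>_def)
    \<comment> \<open>Every point of the two balls is within 5 d / 4 of \<open>z\<close>, hence
      within (5/2) d |z| because |z| > 1/2, and \<open>polar_near\<close> doubles this to 5 d. The
      area constant is 4 * 10^2 = 400.\<close>
    have ab: "\<theta> - 5 * d < \<theta> + 5 * d" "(\<theta> + 5 * d) - (\<theta> - 5 * d) \<le> 2 * pi"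
      "{\<theta> - 5 * d<..<\<theta> + 5 * d} \<subseteq> {\<theta> - 5 * d..\<theta> + 5 * d}"
      "{\<theta> - 5 * d..\<theta> + 5 * d} \<subseteq> {\<theta> - 5 * d..\<theta> + 5 * d}"
      using d0 True pi_gt3 by auto
    define I where "I = cis ` {\<theta> - 5 * d..\<theta> + 5 * d}"
    have E: "emeasure disc_area (carleson_square I) \<le> ennreal (400 * d\<^sup>2)"
    proof -
      have "4 * ((\<theta> + 5 * d) - (\<theta> - 5 * d))\<^sup>2 = 400 * d\<^sup>2"
        by (simp add: power2_eq_square)
      then show ?thesis using emeasure_carleson_square_arc_le[OF ab] by (simp add: I_def)
    qed
    have zw: "norm (z - w) \<le> d"
    proof -
      have "0 \<le> (1 - (norm z)\<^sup>2) * (1 - (norm w)\<^sup>2)"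
        using z w by (intro mult_nonneg_nonneg) (auto simp: power_le_one)
      then have "(norm (z - w))\<^sup>2 \<le> d\<^sup>2" unfolding d norm_one_minus_cnj_mult by simp
      then show ?thesis by (rule power2_le_imp_le) (use d0 in simp)
    qed
    have "x \<in> carleson_square I"
      if x: "x \<noteq> 0" "norm (x - z) < (1 - norm z) / 4 \<or> norm (x - w) < (1 - norm w) / 4" for x
    proof -
      have "norm (x - z) \<le> 5 / 4 * d"
        using x(2)
      proof
        assume "norm (x - w) < (1 - norm w) / 4"
        then show ?thesis
          using norm_triangle_ineq[of "x - w" "w - z"] zw dw norm_minus_commute[of z w] by simp
      qed (use dz d0 in simp)
      moreover have "5 / 2 * d * (1 / 2) \<le> 5 / 2 * d * norm z"
        using d0 nz by (intro mult_left_mono) auto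
      ultimately have "norm (x - z) \<le> 5 / 2 * d * norm z" by simp
      then obtain \<phi> where phi: "\<bar>\<phi> - \<theta>\<bar> \<le> 2 * (5 / 2 * d)" "x = of_real (norm x) * cis \<phi>"
        using polar_near[OF z0 zc, of x "5 / 2 * d"] True by auto
      have "\<phi> \<in> {\<theta> - 5 * d..\<theta> + 5 * d}"
        using abs_le_D1[OF phi(1)] abs_le_D2[OF phi(1)] by simp
      moreover have "norm z - norm x \<le> norm (x - z)"
        using norm_triangle_ineq2[of z x] by (simp add: norm_minus_commute)
      then have "1 - norm x < (\<theta> + 5 * d) - (\<theta> - 5 * d)"
        using \<open>norm (x - z) \<le> 5 / 4 * d\<close> dz d0 by linarith
      ultimately show ?thesis
        unfolding I_def carleson_square_arc_eq[OF ab] using x(1) xlt[OF x(2)] phi(2) by blast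
    qed
    then show thesis
      using that[of I] E arc[OF ab(1)] carleson_square_arc_sets[OF ab] unfolding I_def by auto
  qed
qed

text \<open>Discards all of \<open>Q\<close> except a ball around \<open>x\<close>. The origin, a
  null set, is removed from the ball because Carleson squares do not contain it.\<close>

lemma nn_integral_exp_ball_ge:
  assumes x: "norm x < 1" and r: "r = (1 - norm x) / 4"
    and sub: "\<And>y. y \<noteq> 0 \<Longrightarrow> norm (y - x) < r \<Longrightarrow> y \<in> Q"
    and p: "\<And>y. norm (y - x) < r \<Longrightarrow> c \<le> p y"
  shows "ennreal (exp c * r\<^sup>2) \<le> (\<integral>\<^sup>+y\<in>Q. ennreal (exp (p y)) \<partial>disc_area)"
proof -
  have ball: "ball x r \<subseteq> unit_disc"
  proof
    fix y assume "y \<in> ball x r"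
    then have "norm (y - x) \<le> (1 - norm x) / 2" using x by (simp add: r dist_norm norm_minus_commute)
    then show "y \<in> unit_disc" using hyp_dist_le_1(1)[OF x] by simp
  qed
  have "(ball x r - {0}) \<inter> unit_disc \<in> sets disc_area" by (intro sets_disc_area_Int) auto
  moreover have "(ball x r - {0}) \<inter> unit_disc = ball x r - {0}" using ball by auto
  ultimately have meas: "ball x r - {0} \<in> sets disc_area" by simp
  have "ennreal (exp c * r\<^sup>2) = ennreal (exp c) * emeasure disc_area (ball x r - {0})"
    using x r ball by (simp add: emeasure_disc_area_ball_minus_0 ennreal_mult)
  also have "\<dots> = (\<integral>\<^sup>+y\<in>ball x r - {0}. ennreal (exp c) \<partial>disc_area)"
    using meas by (simp add: nn_integral_cmult_indicator)
  also have "\<dots> \<le> (\<integral>\<^sup>+y\<in>Q. ennreal (exp (p y)) \<partial>disc_area)"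
  proof (intro nn_integral_mono)
    fix y
    show "ennreal (exp c) * indicator (ball x r - {0}) y \<le> ennreal (exp (p y)) * indicator Q y"
    proof (cases "y \<in> ball x r - {0}")
      case True
      then have "norm (y - x) < r" "y \<noteq> 0" by (auto simp: dist_norm norm_minus_commute)
      then have "y \<in> Q" "c \<le> p y" using sub p by auto
      then show ?thesis using True by (simp add: ennreal_leI)
    qed simp
  qed
  finally show ?thesis .
qed

text \<open>In a square joining z and w, the average of e^(f/t) is bounded below by the ball at z,
  that of e^(-f/t) by the ball at w; on these balls f varies by at most 2 C from the centre. Each
  average carries a factor 1 / d^2, so e^((f z - f w) / t) is bounded by a multiple of (e^(2
  \<beta>))^2, whence the 4 in 4 t.\<close>

lemma B2_weight_imp_quasi_lipschitz:
  fixes f :: "complex \<Rightarrow> real"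
  assumes t: "0 < t" and B2: "B2_weight (\<lambda>z. exp (f z / t))"
    and osc: "\<And>z w. norm z < 1 \<Longrightarrow> norm w < 1 \<Longrightarrow> \<bar>f z - f w\<bar> \<le> C * (1 + hyp_dist z w)"
    and C: "0 \<le> C"
  obtains C' where "\<And>z w. norm z < 1 \<Longrightarrow> norm w < 1 \<Longrightarrow> \<bar>f z - f w\<bar> \<le> 4 * t * hyp_dist z w + C'"
proof -
  obtain B0 where B0: "B2_const_sq (\<lambda>z. exp (f z / t)) = ennreal B0"
    using B2 unfolding B2_weight_def by (cases "B2_const_sq (\<lambda>z. exp (f z / t))") auto
  \<comment> \<open>Raising the constant to at least 1 makes \<open>K\<close> positive, so that its
    logarithm can be used.\<close>
  define B where "B = max 1 B0"
  have B: "1 \<le> B" "B2_const_sq (\<lambda>z. exp (f z / t)) \<le> ennreal B" by (auto simp: B_def B0 ennreal_leI)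
  \<comment> \<open>The square of 400 comes from the two averages. The 4096 is 16^2, from the radii
    of a quarter of the boundary distance, times 4^2, which is put back so that the expression in
    \<open>hyp_dist_ge\<close> appears squared.\<close>
  define K where "K = B * 400\<^sup>2 * 4096"
  have K: "0 < K" using B by (simp add: K_def)
  have half: "f z - f w \<le> 4 * t * hyp_dist z w + (t * ln K + 4 * C)"
    if z: "norm z < 1" and w: "norm w < 1" for z w
  proof -
    define d where "d = norm (1 - cnj z * w)"
    define rz rw where "rz = (1 - norm z) / 4" and "rw = (1 - norm w) / 4"
    have r: "0 < rz" "0 < rw" using z w by (auto simp: rz_def rw_def)
    have d: "0 < d" using one_minus_cnj_mult_pos[OF z w] by (simp add: d_def)
    obtain I where I: "I \<in> arcs" "carleson_square I \<in> sets disc_area"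
      and E: "emeasure disc_area (carleson_square I) \<le> ennreal (400 * d\<^sup>2)"
      and sub: "\<And>x. x \<noteq> 0 \<Longrightarrow> norm (x - z) < rz \<or> norm (x - w) < rw \<Longrightarrow> x \<in> carleson_square I"
      unfolding rz_def rw_def by (rule carleson_square_joining[OF z w d_def]) blast
    define X Y where "X = (\<integral>\<^sup>+y\<in>carleson_square I. ennreal (exp (f y / t)) \<partial>disc_area)"
      and "Y = (\<integral>\<^sup>+y\<in>carleson_square I. ennreal (inverse (exp (f y / t))) \<partial>disc_area)"
    have near: "\<bar>f x - f y\<bar> \<le> 2 * C" if "norm x < 1" "norm (y - x) < (1 - norm x) / 4" for x y
    proof -
      have "norm (y - x) \<le> (1 - norm x) / 2" using that by (simp add: field_simps)
      note y = hyp_dist_le_1[OF that(1) this]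
      have "\<bar>f x - f y\<bar> \<le> C * (1 + hyp_dist x y)" using osc that y by simp
      also have "\<dots> \<le> C * (1 + 1)" using C y by (intro mult_left_mono) auto
      finally show ?thesis by simp
    qed
    have X: "ennreal (exp ((f z - 2 * C) / t) * rz\<^sup>2) \<le> X"
      unfolding X_def
    proof (rule nn_integral_exp_ball_ge[OF z rz_def])
      fix y assume "norm (y - z) < rz"
      from abs_le_D1[OF near[OF z this[unfolded rz_def]]]
      show "(f z - 2 * C) / t \<le> f y / t" using t by (intro divide_right_mono) auto
    qed (use sub in blast)
    have "ennreal (exp ((- f w - 2 * C) / t) * rw\<^sup>2)
        \<le> (\<integral>\<^sup>+y\<in>carleson_square I. ennreal (exp (- (f y / t))) \<partial>disc_area)"
    proof (rule nn_integral_exp_ball_ge[OF w rw_def])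
      fix y assume "norm (y - w) < rw"
      from abs_le_D2[OF near[OF w this[unfolded rw_def]]]
      have "(- f w - 2 * C) / t \<le> - f y / t" using t by (intro divide_right_mono) auto
      then show "(- f w - 2 * C) / t \<le> - (f y / t)" by simp
    qed (use sub in blast)
    then have Y: "ennreal (exp ((- f w - 2 * C) / t) * rw\<^sup>2) \<le> Y"
      unfolding Y_def exp_minus .
    define e where "e = emeasure disc_area (carleson_square I)"
    \<comment> \<open>For e = 0 the right side is infinite in \<open>ennreal\<close>; otherwise this
      is the reciprocal of the area bound.\<close>
    have e: "ennreal (1 / (400 * d\<^sup>2)) \<le> 1 / e"
    proof (cases "e = 0")
      case False
      then obtain e' where e': "e = ennreal e'" "0 < e'" "e' \<le> 400 * d\<^sup>2"
        using E unfolding e_def[symmetric] by (cases e) (auto simp: ennreal_le_iff top_unique less_le)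
      have "1 / (400 * d\<^sup>2) \<le> 1 / e'" using e' d by (intro divide_left_mono mult_pos_pos) auto
      moreover have "1 / e = ennreal (1 / e')" using e' by (simp add: divide_ennreal flip: ennreal_1)
      ultimately show ?thesis by (simp add: ennreal_leI)
    qed simp
    have "ennreal (1 / (400 * d\<^sup>2)) * ennreal (exp ((f z - 2 * C) / t) * rz\<^sup>2)
        * (ennreal (1 / (400 * d\<^sup>2)) * ennreal (exp ((- f w - 2 * C) / t) * rw\<^sup>2))
      \<le> 1 / e * X * (1 / e * Y)"
      using e X Y by (intro mult_mono) auto
    also have "\<dots> \<le> B2_const_sq (\<lambda>z. exp (f z / t))"
      unfolding B2_const_sq_def X_def Y_def e_def by (rule SUP_upper) (rule I)
    also note B(2)
    finally have "1 / (400 * d\<^sup>2) * (exp ((f z - 2 * C) / t) * rz\<^sup>2)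
        * (1 / (400 * d\<^sup>2) * (exp ((- f w - 2 * C) / t) * rw\<^sup>2)) \<le> B"
      using B(1) by (simp add: ennreal_mult[symmetric] ennreal_le_iff)
    moreover have "exp ((f z - 2 * C) / t) * exp ((- f w - 2 * C) / t) = exp ((f z - f w - 4 * C) / t)"
      by (simp add: exp_add[symmetric] add_divide_distrib[symmetric])
    then have "1 / (400 * d\<^sup>2) * (exp ((f z - 2 * C) / t) * rz\<^sup>2)
        * (1 / (400 * d\<^sup>2) * (exp ((- f w - 2 * C) / t) * rw\<^sup>2))
      = exp ((f z - f w - 4 * C) / t) * (rz\<^sup>2 * rw\<^sup>2) / (400 * d\<^sup>2)\<^sup>2"
      by (simp add: power2_eq_square mult_ac)
    ultimately have "exp ((f z - f w - 4 * C) / t) * (rz\<^sup>2 * rw\<^sup>2) / (400 * d\<^sup>2)\<^sup>2 \<le> B" by (simp only:)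
    then have "exp ((f z - f w - 4 * C) / t) \<le> B * (400 * d\<^sup>2)\<^sup>2 / (rz\<^sup>2 * rw\<^sup>2)"
      using r d by (simp add: field_simps)
    also have "\<dots> = K * (d\<^sup>2 / (4 * ((1 - norm z) * (1 - norm w))))\<^sup>2"
    proof -
      have "1 - norm z = 4 * rz" "1 - norm w = 4 * rw" by (auto simp: rz_def rw_def)
      then show ?thesis using r by (simp add: K_def power_divide power_mult_distrib mult_ac)
    qed
    finally have "(f z - f w - 4 * C) / t \<le> ln (K * (d\<^sup>2 / (4 * ((1 - norm z) * (1 - norm w))))\<^sup>2)"
      using K d z w by (subst ln_ge_iff) (auto intro!: mult_pos_pos divide_pos_pos)
    also have "\<dots> = ln K + 2 * ln (d\<^sup>2 / (4 * ((1 - norm z) * (1 - norm w))))"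
      using K d z w by (subst ln_mult_pos) (auto simp: ln_realpow intro!: divide_pos_pos)
    also have "\<dots> \<le> ln K + 4 * hyp_dist z w"
      using hyp_dist_ge[OF z w] unfolding d_def by simp
    finally have "f z - f w - 4 * C \<le> t * (ln K + 4 * hyp_dist z w)"
      using t by (simp add: pos_divide_le_eq mult.commute)
    then show ?thesis by (simp add: algebra_simps)
  qed
  show thesis
  proof (rule that[of "t * ln K + 4 * C"])
    fix z w :: complex assume zw: "norm z < 1" "norm w < 1"
    show "\<bar>f z - f w\<bar> \<le> 4 * t * hyp_dist z w + (t * ln K + 4 * C)"
      using half[OF zw] half[OF zw(2,1)] hyp_dist_commute[of z w] by (simp add: abs_le_iff)
  qed
qed

section \<open>Bounded mean oscillation\<close>

text \<open>The bound on |g - a| also shows that \<open>g\<close> is integrable over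
  \<open>S\<close>, so the Bochner integral in \<open>disc_mean\<close> is the genuine one and not
  the default value 0.\<close>

lemma disc_mean_diff_le:
  assumes S: "S \<in> sets disc_area" and g: "g \<in> borel_measurable disc_area"
    and pos: "0 < measure disc_area S" and B: "0 \<le> B"
    and le: "(\<integral>\<^sup>+z\<in>S. ennreal \<bar>g z - a\<bar> \<partial>disc_area) \<le> ennreal (B * measure disc_area S)"
  shows "\<bar>disc_mean g S - a\<bar> \<le> B"
proof -
  interpret finite_measure disc_area by (rule finite_measure_disc_area)
  define p where "p = (\<lambda>z. indicator S z *\<^sub>R (g z - a))"
  have nn: "(\<integral>\<^sup>+z. ennreal (norm (p z)) \<partial>disc_area) = (\<integral>\<^sup>+z\<in>S. ennreal \<bar>g z - a\<bar> \<partial>disc_area)"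
    by (intro nn_integral_cong) (auto simp: p_def indicator_def)
  have int_p: "integrable disc_area p"
  proof (rule integrableI_bounded)
    show "p \<in> borel_measurable disc_area" unfolding p_def using S g by measurable
    show "(\<integral>\<^sup>+z. ennreal (norm (p z)) \<partial>disc_area) < \<infinity>"
      unfolding nn using le by (simp add: le_less_trans[OF _ ennreal_less_top])
  qed
  have int_a: "integrable disc_area (\<lambda>z. indicator S z *\<^sub>R a)"
    using S by (intro integrable_scaleR_left integrable_real_indicator) (auto simp: less_top[symmetric])
  have "(LINT z:S|disc_area. g z) = (LINT z|disc_area. p z + indicator S z *\<^sub>R a)"
    unfolding set_lebesgue_integral_def p_def by (simp add: algebra_simps)
  also have "\<dots> = (LINT z|disc_area. p z) + measure disc_area S * a"
    using int_p int_a sets.sets_into_space[OF S] by (simp add: Int_absorb2)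
  finally have "disc_mean g S - a = (LINT z|disc_area. p z) / measure disc_area S"
    using pos by (simp add: disc_mean_def field_simps)
  moreover have "ennreal (norm (LINT z|disc_area. p z)) \<le> ennreal (B * measure disc_area S)"
    using integral_norm_bound_ennreal[OF int_p] nn le by simp
  then have "norm (LINT z|disc_area. p z) \<le> B * measure disc_area S"
    using B by (simp add: ennreal_le_iff)
  ultimately show ?thesis using pos by (simp add: pos_divide_le_eq)
qed

text \<open>Any constant may replace the mean at the price of a factor 2, because the mean itself is
  within \<open>B\<close> of that constant.\<close>

lemma BMO_norm_leI:
  assumes g: "g \<in> borel_measurable disc_area" and B: "0 \<le> B"
    and le: "\<And>c r. norm c < 1 \<Longrightarrow> 0 < r \<Longrightarrow> \<exists>a.
      (\<integral>\<^sup>+z\<in>ball c r \<inter> unit_disc. ennreal \<bar>g z - a\<bar> \<partial>disc_area)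
        \<le> ennreal (B * measure disc_area (ball c r \<inter> unit_disc))"
    and pos: "\<And>c r. norm c < 1 \<Longrightarrow> 0 < r \<Longrightarrow> 0 < measure disc_area (ball c r \<inter> unit_disc)"
  shows "BMO_norm g \<le> ennreal (2 * B)"
  unfolding BMO_norm_def
proof (rule SUP_least, clarsimp)
  fix c :: complex and r :: real assume c: "norm c < 1" and r: "0 < r"
  interpret finite_measure disc_area by (rule finite_measure_disc_area)
  define S where "S = ball c r \<inter> unit_disc"
  have S: "S \<in> sets disc_area" unfolding S_def by (intro sets_disc_area_Int) auto
  define E where "E = measure disc_area S"
  have E: "0 < E" using pos[OF c r] by (simp add: E_def S_def)
  obtain a where a: "(\<integral>\<^sup>+z\<in>S. ennreal \<bar>g z - a\<bar> \<partial>disc_area) \<le> ennreal (B * E)"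
    using le[OF c r] unfolding S_def E_def by blast
  have m: "\<bar>disc_mean g S - a\<bar> \<le> B"
    using disc_mean_diff_le[OF S g _ B a[unfolded E_def]] E by (simp add: E_def)
  have "(\<integral>\<^sup>+z\<in>S. ennreal \<bar>g z - disc_mean g S\<bar> \<partial>disc_area)
      \<le> (\<integral>\<^sup>+z. ennreal \<bar>g z - a\<bar> * indicator S z + ennreal B * indicator S z \<partial>disc_area)"
  proof (intro nn_integral_mono)
    fix z
    have "\<bar>g z - disc_mean g S\<bar> \<le> \<bar>g z - a\<bar> + \<bar>disc_mean g S - a\<bar>" by linarith
    with m have "\<bar>g z - disc_mean g S\<bar> \<le> \<bar>g z - a\<bar> + B" by linarith
    then have "ennreal \<bar>g z - disc_mean g S\<bar> \<le> ennreal \<bar>g z - a\<bar> + ennreal B"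
      using B by (simp add: ennreal_leI flip: ennreal_plus)
    then show "ennreal \<bar>g z - disc_mean g S\<bar> * indicator S z
        \<le> ennreal \<bar>g z - a\<bar> * indicator S z + ennreal B * indicator S z"
      by (auto simp: indicator_def)
  qed
  also have "\<dots> = (\<integral>\<^sup>+z\<in>S. ennreal \<bar>g z - a\<bar> \<partial>disc_area) + ennreal B * emeasure disc_area S"
    using S g by (subst nn_integral_add) (auto simp: nn_integral_cmult_indicator)
  also have "\<dots> \<le> ennreal (B * E) + ennreal B * ennreal E"
    using a by (intro add_mono) (auto simp: E_def emeasure_eq_measure)
  also have "\<dots> = ennreal (2 * B * E)"
    using B E by (simp flip: ennreal_mult ennreal_plus)
  finally have int: "(\<integral>\<^sup>+z\<in>S. ennreal \<bar>g z - disc_mean g S\<bar> \<partial>disc_area) \<le> ennreal (2 * B * E)" .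
  have "1 / emeasure disc_area S * (\<integral>\<^sup>+z\<in>S. ennreal \<bar>g z - disc_mean g S\<bar> \<partial>disc_area)
      \<le> ennreal (1 / E) * ennreal (2 * B * E)"
    using E by (intro mult_mono int one_divide_ennreal_le) (auto simp: E_def emeasure_eq_measure)
  also have "\<dots> = ennreal (2 * B)"
    using E B by (simp flip: ennreal_mult)
  finally show "1 / emeasure disc_area (ball c r \<inter> unit_disc) *
      (\<integral>\<^sup>+z\<in>ball c r \<inter> unit_disc. ennreal \<bar>g z - disc_mean g (ball c r \<inter> unit_disc)\<bar> \<partial>disc_area)
      \<le> ennreal (2 * B)"
    by (simp add: S_def)
qed

text \<open>The intersection contains a ball of radius r / 2: centred at 0 if |c| \<le> r / 2, and
  otherwise at \<open>c\<close> moved towards 0 by r / 2.\<close>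

lemma measure_disc_area_ball_Int_ge:
  assumes c: "norm c < 1" and r: "0 < r" "r \<le> 1"
  shows "(r / 2)\<^sup>2 \<le> measure disc_area (ball c r \<inter> unit_disc)"
proof -
  interpret finite_measure disc_area by (rule finite_measure_disc_area)
  obtain c' where sub: "ball c' (r / 2) \<subseteq> ball c r \<inter> unit_disc"
  proof (cases "norm c \<le> r / 2")
    case True
    have "ball 0 (r / 2) \<subseteq> ball c r \<inter> unit_disc"
    proof
      fix x :: complex assume "x \<in> ball 0 (r / 2)"
      then have "norm x < r / 2" by simp
      then show "x \<in> ball c r \<inter> unit_disc"
        using True norm_triangle_ineq4[of c x] r by (simp add: dist_norm)
    qed
    then show ?thesis by (rule that)
  next
    case False
    then have c0: "r / 2 < norm c" by simp
    define c' where "c' = of_real (1 - r / (2 * norm c)) * c"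
    have nc: "norm c' = norm c - r / 2"
    proof -
      have "r / (2 * norm c) \<le> 1" using c0 r by (subst divide_le_eq_1_pos) auto
      then have "norm c' = (1 - r / (2 * norm c)) * norm c"
        unfolding c'_def norm_mult norm_of_real by simp
      moreover have "norm c \<noteq> 0" using c0 r by linarith
      ultimately show ?thesis by (simp add: field_simps)
    qed
    have cc: "norm (c - c') = r / 2"
    proof -
      have "c - c' = of_real (r / (2 * norm c)) * c" by (simp add: c'_def algebra_simps)
      then have "norm (c - c') = \<bar>r / (2 * norm c)\<bar> * norm c" by (simp only: norm_mult norm_of_real)
      moreover have "c \<noteq> 0" using c0 r by auto
      ultimately show ?thesis using r by simp
    qed
    have "ball c' (r / 2) \<subseteq> ball c r \<inter> unit_disc"
    proof
      fix x assume "x \<in> ball c' (r / 2)"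
      then have x: "norm (c' - x) < r / 2" by (simp add: dist_norm)
      have "norm (c - x) < r" using norm_triangle_ineq[of "c - c'" "c' - x"] x cc by simp
      moreover have "norm x < 1" using norm_triangle_ineq4[of c' "c' - x"] x nc c by simp
      ultimately show "x \<in> ball c r \<inter> unit_disc" by (simp add: dist_norm)
    qed
    then show ?thesis by (rule that)
  qed
  have "ennreal ((r / 2)\<^sup>2) = emeasure disc_area (ball c' (r / 2))"
    using sub r by (subst emeasure_disc_area_ball) auto
  also have "\<dots> \<le> emeasure disc_area (ball c r \<inter> unit_disc)"
    using sub by (intro emeasure_mono sets_disc_area_Int) auto
  finally show ?thesis by (simp add: emeasure_eq_measure ennreal_le_iff)
qed

lemma measure_disc_area_ball_Int_pos:
  assumes "norm c < 1" "0 < r"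
  shows "0 < measure disc_area (ball c r \<inter> unit_disc)"
proof -
  interpret finite_measure disc_area by (rule finite_measure_disc_area)
  have "0 < (min r 1 / 2)\<^sup>2" using assms by simp
  also have "\<dots> \<le> measure disc_area (ball c (min r 1) \<inter> unit_disc)"
    using assms by (intro measure_disc_area_ball_Int_ge) auto
  also have "\<dots> \<le> measure disc_area (ball c r \<inter> unit_disc)"
    by (intro finite_measure_mono sets_disc_area_Int) auto
  finally show ?thesis .
qed

text \<open>A ball whose radius exceeds half the boundary distance of its centre is comparable in
  area to a box containing it. For r < 1/8 the size l = 4 r suffices, as the depth is below 3 r and
  the angle is controlled by \<open>polar_near\<close>. For r \<ge> 1/8 the box of size 4 is the
  whole disc, and 4 / 64 = (1/8) / 2.\<close>

lemma ball_Int_subset_polar_box: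
  assumes c: "norm c < 1" and r: "(1 - norm c) / 2 < r"
  obtains \<theta> l where "0 < l" "ball c r \<inter> unit_disc \<subseteq> polar_box \<theta> l"
    "(l / 64)\<^sup>2 \<le> measure disc_area (ball c r \<inter> unit_disc)"
proof (cases "r < 1 / 8")
  case False
  interpret finite_measure disc_area by (rule finite_measure_disc_area)
  have "(4 / 64)\<^sup>2 = (1 / 8 / 2 :: real)\<^sup>2" by simp
  also have "\<dots> \<le> measure disc_area (ball c (1 / 8) \<inter> unit_disc)"
    using c by (intro measure_disc_area_ball_Int_ge) auto
  also have "\<dots> \<le> measure disc_area (ball c r \<inter> unit_disc)"
    using False by (intro finite_measure_mono sets_disc_area_Int) auto
  finally show thesis using that[of 4 0] unit_disc_subset_polar_box by auto
next
  case True
  have r0: "0 < r" and c34: "3 / 4 < norm c" using True r c by (simp_all add: field_simps)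
  have cc: "c = of_real (norm c) * cis (Arg c)" using rcis_cmod_Arg[of c] by (simp add: rcis_def)
  have c0: "c \<noteq> 0" using c34 by auto
  have "ball c r \<inter> unit_disc \<subseteq> polar_box (Arg c) (4 * r)"
  proof
    fix z assume "z \<in> ball c r \<inter> unit_disc"
    then have z: "norm (z - c) < r" "norm z < 1" by (auto simp: dist_norm norm_minus_commute)
    have "2 * r * (1 / 2) \<le> 2 * r * norm c" using r0 c34 by (intro mult_left_mono) auto
    then have "norm (z - c) \<le> 2 * r * norm c" using z by simp
    then obtain \<phi> where phi: "\<bar>\<phi> - Arg c\<bar> \<le> 2 * (2 * r)" "z = of_real (norm z) * cis \<phi>"
      using polar_near[OF c0 cc, of z "2 * r"] True by auto
    have "norm c - norm z \<le> norm (z - c)"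
      using norm_triangle_ineq2[of c z] by (simp add: norm_minus_commute)
    then have "1 - norm z < 4 * r" using z(1) r r0 by (simp add: field_simps)
    with phi z show "z \<in> polar_box (Arg c) (4 * r)" by (auto simp: polar_box_def)
  qed
  moreover have "(4 * r / 64)\<^sup>2 \<le> (r / 2)\<^sup>2" using r0 by (intro power_mono) auto
  then have "(4 * r / 64)\<^sup>2 \<le> measure disc_area (ball c r \<inter> unit_disc)"
    using measure_disc_area_ball_Int_ge[OF c r0] True by simp
  ultimately show thesis using that[of "4 * r" "Arg c"] r0 by simp
qed

text \<open>Replaces the logarithmic distance to the top of a box by a power with exponent below 1,
  to which the box integral applies.\<close>

lemma ln_le_sqrt:
  fixes x :: real
  assumes "0 < x"
  shows "1 / 2 * ln (36 * x) \<le> 6 * x powr (1 / 2)"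
proof -
  have "1 / 2 * ln (36 * x) = ln ((36 * x) powr (1 / 2))" using assms by (simp add: ln_powr)
  also have "(36 * x) powr (1 / 2) = 6 * x powr (1 / 2)"
    using assms by (simp add: powr_mult powr_half_sqrt)
  also have "ln (6 * x powr (1 / 2)) \<le> 6 * x powr (1 / 2)"
    using ln_le_minus_one[of "6 * x powr (1 / 2)"] assms by simp
  finally show ?thesis .
qed

text \<open>A ball of radius at most half the boundary distance of its centre lies within hyperbolic
  distance 1 of it, so the value at the centre is a good constant. A larger ball is enclosed in a
  box of comparable area and compared with the value at the top of that box.\<close>

lemma BMO_norm_le_of_hyp_lipschitz:
  fixes g :: "complex \<Rightarrow> real"
  assumes L: "0 \<le> L"
    and lip: "\<And>z w. norm z < 1 \<Longrightarrow> norm w < 1 \<Longrightarrow> \<bar>g z - g w\<bar> \<le> L * hyp_dist z w"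
  shows "BMO_norm g \<le> ennreal (2 * (L * (6 * box_const (1 / 2) * 64\<^sup>2 + 1)))"
proof (rule BMO_norm_leI)
  interpret finite_measure disc_area by (rule finite_measure_disc_area)
  define K where "K = 6 * box_const (1 / 2) * 64\<^sup>2"
  have K: "0 \<le> K" using box_const_pos[of "1 / 2"] by (simp add: K_def)
  show "g \<in> borel_measurable disc_area" using lip by (rule borel_measurable_of_hyp_lipschitz)
  show "0 \<le> L * (6 * box_const (1 / 2) * 64\<^sup>2 + 1)"
    using L box_const_pos[of "1 / 2"] by simp
  fix c :: complex and r :: real assume c: "norm c < 1" and r: "0 < r"
  show "0 < measure disc_area (ball c r \<inter> unit_disc)"
    using c r by (rule measure_disc_area_ball_Int_pos)
  define S where "S = ball c r \<inter> unit_disc"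
  have S: "S \<in> sets disc_area" unfolding S_def by (intro sets_disc_area_Int) auto
  show "\<exists>a. (\<integral>\<^sup>+z\<in>ball c r \<inter> unit_disc. ennreal \<bar>g z - a\<bar> \<partial>disc_area)
      \<le> ennreal (L * (6 * box_const (1 / 2) * 64\<^sup>2 + 1) * measure disc_area (ball c r \<inter> unit_disc))"
    unfolding S_def[symmetric] K_def[symmetric]
  proof (cases "r \<le> (1 - norm c) / 2")
    case True
    have "(\<integral>\<^sup>+z\<in>S. ennreal \<bar>g z - g c\<bar> \<partial>disc_area) \<le> (\<integral>\<^sup>+z. ennreal L * indicator S z \<partial>disc_area)"
    proof (intro nn_integral_mono)
      fix z
      show "ennreal \<bar>g z - g c\<bar> * indicator S z \<le> ennreal L * indicator S z"
      proof (cases "z \<in> S")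
        case zS: True
        then have "norm (z - c) \<le> (1 - norm c) / 2" "norm z < 1"
          using True by (auto simp: S_def dist_norm norm_minus_commute)
        then have "hyp_dist c z \<le> 1" using hyp_dist_le_1[OF c] by simp
        then have "\<bar>g z - g c\<bar> \<le> L * 1"
          using lip[OF \<open>norm z < 1\<close> c] L hyp_dist_commute[of z c] mult_left_mono[of "hyp_dist c z" 1 L]
          by simp
        then show ?thesis using zS by (simp add: ennreal_leI)
      qed simp
    qed
    also have "\<dots> = ennreal (L * measure disc_area S)"
      using S L by (simp add: nn_integral_cmult_indicator emeasure_eq_measure ennreal_mult)
    also have "\<dots> \<le> ennreal (L * (K + 1) * measure disc_area S)"
      using L K by (intro ennreal_leI mult_right_mono) (auto simp: algebra_simps)
    finally show "\<exists>a. (\<integral>\<^sup>+z\<in>S. ennreal \<bar>g z - a\<bar> \<partial>disc_area)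
      \<le> ennreal (L * (K + 1) * measure disc_area S)" by blast
  next
    case False
    then have "(1 - norm c) / 2 < r" by simp
    then obtain \<theta> l where l: "0 < l" and sub: "S \<subseteq> polar_box \<theta> l"
      and area: "(l / 64)\<^sup>2 \<le> measure disc_area S"
      using ball_Int_subset_polar_box[OF c] unfolding S_def by metis
    define w where "w = box_top \<theta> l"
    have w: "norm w < 1" using l by (simp add: w_def norm_box_top_less_1)
    have "(\<integral>\<^sup>+z\<in>S. ennreal \<bar>g z - g w\<bar> \<partial>disc_area)
      \<le> (\<integral>\<^sup>+z\<in>polar_box \<theta> l. ennreal (L * 6 * (l / (1 - norm z)) powr (1 / 2)) \<partial>disc_area)"
    proof (intro nn_integral_mono)
      fix z
      show "ennreal \<bar>g z - g w\<bar> * indicator S z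
        \<le> ennreal (L * 6 * (l / (1 - norm z)) powr (1 / 2)) * indicator (polar_box \<theta> l) z"
      proof (cases "z \<in> S")
        case True
        then have z: "z \<in> polar_box \<theta> l" "norm z < 1" using sub by (auto simp: S_def)
        then have x: "0 < l / (1 - norm z)" using l by simp
        have "\<bar>g z - g w\<bar> \<le> L * hyp_dist z w" using lip z w by simp
        also have "\<dots> \<le> L * (6 * (l / (1 - norm z)) powr (1 / 2))"
          using L hyp_dist_box_top_le[OF l z(1)] ln_le_sqrt[OF x] unfolding w_def
          by (intro mult_left_mono) auto
        finally show ?thesis using True z by (simp add: ennreal_leI mult.assoc)
      qed simp
    qed
    also have "\<dots> \<le> ennreal (L * 6 * box_const (1 / 2) * l\<^sup>2)"
      using L l by (intro nn_integral_polar_box_cmult_le) auto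
    also have "\<dots> \<le> ennreal (L * (K + 1) * measure disc_area S)"
    proof (rule ennreal_leI)
      have "L * 6 * box_const (1 / 2) * l\<^sup>2 = L * K * (l / 64)\<^sup>2"
        by (simp add: K_def power_divide)
      also have "\<dots> \<le> L * (K + 1) * measure disc_area S"
        using L K area by (intro mult_mono) (auto simp: algebra_simps)
      finally show "L * 6 * box_const (1 / 2) * l\<^sup>2 \<le> L * (K + 1) * measure disc_area S" .
    qed
    finally show "\<exists>a. (\<integral>\<^sup>+z\<in>S. ennreal \<bar>g z - a\<bar> \<partial>disc_area)
      \<le> ennreal (L * (K + 1) * measure disc_area S)" by blast
  qed
qed

section \<open>From a BMO bound back to a quasi-Lipschitz estimate\<close>

lemma BMO_norm_leD:
  assumes "BMO_norm g \<le> ennreal N" "0 \<le> N" "norm c < 1" "0 < r"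
  shows "(\<integral>\<^sup>+z\<in>ball c r \<inter> unit_disc. ennreal \<bar>g z - disc_mean g (ball c r \<inter> unit_disc)\<bar> \<partial>disc_area)
    \<le> ennreal (N * measure disc_area (ball c r \<inter> unit_disc))"
proof -
  interpret finite_measure disc_area by (rule finite_measure_disc_area)
  define S E where "S = ball c r \<inter> unit_disc" and "E = measure disc_area S"
  have E: "0 < E" using measure_disc_area_ball_Int_pos assms(3,4) by (simp add: E_def S_def)
  define X where "X = (\<integral>\<^sup>+z\<in>S. ennreal \<bar>g z - disc_mean g S\<bar> \<partial>disc_area)"
  have "1 / emeasure disc_area S * X \<le> BMO_norm g"
    unfolding BMO_norm_def X_def S_def using assms(3,4) by (intro SUP_upper2[of "(c, r)"]) auto
  then have "ennreal (1 / E) * X \<le> ennreal N"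
    using assms(1) E by (simp add: emeasure_eq_measure E_def[symmetric] divide_ennreal flip: ennreal_1)
  then have "ennreal E * (ennreal (1 / E) * X) \<le> ennreal E * ennreal N" by (intro mult_left_mono) auto
  also have "ennreal E * (ennreal (1 / E) * X) = X"
    using E by (simp add: mult.assoc[symmetric] flip: ennreal_mult)
  also have "ennreal E * ennreal N = ennreal (N * E)"
    using E assms(2) by (simp add: mult.commute flip: ennreal_mult)
  finally show ?thesis by (simp add: X_def S_def E_def)
qed

text \<open>The means F of f - h over balls of a quarter of the boundary distance stay within 2 C +
  M of f. At hyperbolic distance at most artanh (1/17) two such balls lie in a common ball of
  comparable area, so F changes by at most 10 N there, and \<open>hyp_chain\<close> extends this to
  all distances.\<close>

lemma quasi_lipschitz_of_BMO_norm:
  fixes f :: "complex \<Rightarrow> real"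
  assumes f: "f \<in> borel_measurable disc_area" and h: "h \<in> Linfty_disc"
    and N: "0 \<le> N" "BMO_norm (\<lambda>z. f z - h z) \<le> ennreal N"
    and osc: "\<And>z w. norm z < 1 \<Longrightarrow> norm w < 1 \<Longrightarrow> \<bar>f z - f w\<bar> \<le> C * (1 + hyp_dist z w)"
    and C: "0 \<le> C"
  obtains C' where "\<And>z w. norm z < 1 \<Longrightarrow> norm w < 1 \<Longrightarrow>
    \<bar>f z - f w\<bar> \<le> 10 * N / artanh (1 / 17) * hyp_dist z w + C'"
proof -
  interpret finite_measure disc_area by (rule finite_measure_disc_area)
  obtain M0 where M0: "AE z in disc_area. \<bar>h z\<bar> \<le> M0" using h by (auto simp: Linfty_disc_def)
  define M where "M = max 0 M0"
  have M: "AE z in disc_area. \<bar>h z\<bar> \<le> M" "0 \<le> M" using M0 by (auto simp: M_def)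
  define g where "g = (\<lambda>z. f z - h z)"
  have g: "g \<in> borel_measurable disc_area"
    unfolding g_def using f h by (intro borel_measurable_diff) (auto simp: Linfty_disc_def)
  have sub: "ball z r \<subseteq> unit_disc" if "norm z < 1" "r \<le> (1 - norm z) / 2" for z r
  proof
    fix x assume "x \<in> ball z r"
    then show "x \<in> unit_disc" using hyp_dist_le_1(1)[OF that(1), of x] that(2)
      by (simp add: dist_norm norm_minus_commute)
  qed
  have meas: "ball z r \<in> sets disc_area" "measure disc_area (ball z r) = r\<^sup>2"
    if "norm z < 1" "r \<le> (1 - norm z) / 2" "0 \<le> r" for z r
  proof -
    have "ball z r \<inter> unit_disc \<in> sets disc_area" by (intro sets_disc_area_Int) auto
    then show "ball z r \<in> sets disc_area" using sub[OF that(1,2)] by (simp add: Int_absorb2)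
    show "measure disc_area (ball z r) = r\<^sup>2"
      using emeasure_disc_area_ball[OF that(3) sub[OF that(1,2)]] by (simp add: measure_def)
  qed
  define F where "F = (\<lambda>z. disc_mean g (ball z ((1 - norm z) / 4)))"
  have FF: "\<bar>F z - F w\<bar> \<le> 10 * N"
    if z: "norm z < 1" and w: "norm w < 1" and d: "hyp_dist z w \<le> artanh (1 / 17)" for z w
  proof -
    define R where "R = 1 - norm z"
    have R: "0 < R" using z by (simp add: R_def)
    define T where "T = ball z (R / 2)"
    define m where "m = disc_mean g T"
    have Tu: "T \<inter> unit_disc = T" unfolding T_def R_def using sub[OF z] by (simp add: Int_absorb2)
    have mT: "measure disc_area T = (R / 2)\<^sup>2" unfolding T_def using meas(2)[OF z] R by (simp add: R_def)
    have int: "(\<integral>\<^sup>+x\<in>T. ennreal \<bar>g x - m\<bar> \<partial>disc_area) \<le> ennreal (N * (R / 2)\<^sup>2)"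
      using BMO_norm_leD[OF N(2)[folded g_def] N(1) z, of "R / 2"] R
      unfolding T_def[symmetric] Tu m_def[symmetric] mT by simp
    have mean: "\<bar>disc_mean g (ball v s) - m\<bar> \<le> k * N"
      if v: "norm v < 1" "s \<le> (1 - norm v) / 2" "0 < s" and vs: "ball v s \<subseteq> T"
        and k: "(R / 2)\<^sup>2 \<le> k * s\<^sup>2" "0 \<le> k" for v s k
    proof (rule disc_mean_diff_le[OF _ g])
      show "ball v s \<in> sets disc_area" "0 < measure disc_area (ball v s)"
        using meas[OF v(1,2)] v(3) by auto
      show "0 \<le> k * N" using k N by simp
      have "(\<integral>\<^sup>+x\<in>ball v s. ennreal \<bar>g x - m\<bar> \<partial>disc_area) \<le> (\<integral>\<^sup>+x\<in>T. ennreal \<bar>g x - m\<bar> \<partial>disc_area)"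
        using vs by (intro nn_integral_mono) (auto simp: indicator_def)
      also note int
      also have "ennreal (N * (R / 2)\<^sup>2) \<le> ennreal (k * N * measure disc_area (ball v s))"
        using meas(2)[OF v(1,2)] v(3) mult_left_mono[OF k(1) N(1)]
        by (intro ennreal_leI) (simp add: mult_ac)
      finally show "(\<integral>\<^sup>+x\<in>ball v s. ennreal \<bar>g x - m\<bar> \<partial>disc_area)
        \<le> ennreal (k * N * measure disc_area (ball v s))" .
    qed
    \<comment> \<open>Radius R / 4 inside radius R / 2: the area ratio is 4.\<close>
    have "\<bar>F z - m\<bar> \<le> 4 * N"
      unfolding F_def using z R
      by (intro mean) (auto simp: R_def T_def power_divide subset_ball)
    moreover have "\<bar>F w - m\<bar> \<le> 6 * N"
    proof -
      have nwz: "norm (w - z) \<le> R / 8" using norm_diff_le_of_hyp_dist[OF z w d] by (simp add: R_def)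
      have "norm w - norm z \<le> norm (w - z)" "norm z - norm w \<le> norm (w - z)"
        using norm_triangle_ineq2[of w z] norm_triangle_ineq2[of z w] by (simp_all add: norm_minus_commute)
      then have Rw: "7 * R \<le> 8 * (1 - norm w)" "8 * (1 - norm w) \<le> 9 * R"
        using nwz by (simp_all add: R_def field_simps)
      show ?thesis
        unfolding F_def
      proof (rule mean[OF w])
        show "(1 - norm w) / 4 \<le> (1 - norm w) / 2" "0 < (1 - norm w) / 4" using w by auto
        show "ball w ((1 - norm w) / 4) \<subseteq> T"
        proof
          fix x assume "x \<in> ball w ((1 - norm w) / 4)"
          then have "norm (x - w) < (1 - norm w) / 4" by (simp add: dist_norm norm_minus_commute)
          then have "norm (x - z) < R / 2"
            using norm_triangle_ineq[of "x - w" "w - z"] nwz Rw R by (simp add: field_simps)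
          then show "x \<in> T" by (simp add: T_def dist_norm norm_minus_commute)
        qed
        \<comment> \<open>The ball at \<open>w\<close> has radius at least 7 R / 32, so the area
          ratio is at most (16/7)^2, which is below 6.\<close>
        have "(7 * R / 32)\<^sup>2 \<le> ((1 - norm w) / 4)\<^sup>2"
          using Rw(1) R by (intro power_mono) auto
        then have "49 * R\<^sup>2 \<le> 64 * (1 - norm w)\<^sup>2"
          by (simp add: power_divide power_mult_distrib)
        then have "2 * R\<^sup>2 \<le> 3 * (1 - norm w)\<^sup>2"
          using zero_le_power2[of "1 - norm w"] by linarith
        then show "(R / 2)\<^sup>2 \<le> 6 * ((1 - norm w) / 4)\<^sup>2"
          by (simp add: power_divide)
      qed simp
    qed
    ultimately show ?thesis by linarith
  qed
  have Ff: "\<bar>F z - f z\<bar> \<le> 2 * C + M" if z: "norm z < 1" for z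
    unfolding F_def
  proof (rule disc_mean_diff_le[OF _ g])
    define B where "B = ball z ((1 - norm z) / 4)"
    have r: "(1 - norm z) / 4 \<le> (1 - norm z) / 2" "0 \<le> (1 - norm z) / 4" using z by auto
    note mB = meas[OF z r, folded B_def]
    show "ball z ((1 - norm z) / 4) \<in> sets disc_area" "0 < measure disc_area (ball z ((1 - norm z) / 4))"
      "0 \<le> 2 * C + M"
      using meas[OF z r] z M C by auto
    have "(\<integral>\<^sup>+x\<in>B. ennreal \<bar>g x - f z\<bar> \<partial>disc_area)
        \<le> (\<integral>\<^sup>+x. ennreal (2 * C + M) * indicator B x \<partial>disc_area)"
    proof (intro nn_integral_mono_AE, use M(1) in eventually_elim)
      case (elim x)
      show ?case
      proof (cases "x \<in> B")
        case True
        then have "norm (x - z) \<le> (1 - norm z) / 2" using z by (simp add: B_def dist_norm norm_minus_commute)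
        note x = hyp_dist_le_1[OF z this]
        have "\<bar>f z - f x\<bar> \<le> C * (1 + hyp_dist z x)" using osc z x by simp
        also have "\<dots> \<le> C * (1 + 1)" using C x by (intro mult_left_mono) auto
        finally have "\<bar>g x - f z\<bar> \<le> 2 * C + M" using elim by (simp add: g_def)
        then show ?thesis using True by (simp add: ennreal_leI)
      qed simp
    qed
    also have "\<dots> = ennreal ((2 * C + M) * measure disc_area B)"
      using mB(1) C M by (simp add: nn_integral_cmult_indicator emeasure_eq_measure ennreal_mult)
    finally show "(\<integral>\<^sup>+x\<in>ball z ((1 - norm z) / 4). ennreal \<bar>g x - f z\<bar> \<partial>disc_area)
        \<le> ennreal ((2 * C + M) * measure disc_area (ball z ((1 - norm z) / 4)))"
      by (simp add: B_def)
  qed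
  have a: "0 < artanh (1 / 17 :: real)" by (simp add: artanh_def)
  show thesis
  proof (rule that[of "10 * N + 2 * (2 * C + M)"])
    fix z w :: complex assume zw: "norm z < 1" "norm w < 1"
    have "\<bar>F z - F w\<bar> \<le> 10 * N / artanh (1 / 17) * hyp_dist z w + 10 * N"
      using hyp_chain[OF a _ FF zw] N by simp
    moreover have "\<bar>f z - f w\<bar> \<le> \<bar>F z - F w\<bar> + (\<bar>F z - f z\<bar> + \<bar>F w - f w\<bar>)" by linarith
    moreover have "\<bar>F z - f z\<bar> + \<bar>F w - f w\<bar> \<le> 2 * (2 * C + M)"
      using Ff[OF zw(1)] Ff[OF zw(2)] by simp
    ultimately show "\<bar>f z - f w\<bar> \<le> 10 * N / artanh (1 / 17) * hyp_dist z w + (10 * N + 2 * (2 * C + M))" by linarith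
  qed
qed

text \<open>Multiplication by a positive finite constant can be undone by its reciprocal, so it
  passes through the infimum; infinite values and an empty index set are covered.\<close>

lemma le_ennreal_mult_INF:
  assumes c: "0 < c" and le: "\<And>i. i \<in> A \<Longrightarrow> X \<le> ennreal c * F i"
  shows "X \<le> ennreal c * (INF i\<in>A. F i)"
proof -
  have inv: "ennreal (1 / c) * ennreal c = 1" using c by (simp flip: ennreal_mult)
  have "ennreal (1 / c) * X \<le> (INF i\<in>A. F i)"
  proof (rule INF_greatest)
    fix i assume "i \<in> A"
    then have "ennreal (1 / c) * X \<le> ennreal (1 / c) * (ennreal c * F i)"
      using le by (intro mult_left_mono) auto
    also have "\<dots> = F i" by (simp add: mult.assoc[symmetric] inv)
    finally show "ennreal (1 / c) * X \<le> F i" .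
  qed
  then have "ennreal c * (ennreal (1 / c) * X) \<le> ennreal c * (INF i\<in>A. F i)"
    by (intro mult_left_mono) auto
  moreover have "ennreal c * (ennreal (1 / c) * X) = X"
    using inv by (metis mult.assoc mult.commute mult.right_neutral)
  ultimately show ?thesis by simp
qed

section \<open>The inequalities between \<open>gamma_B2\<close> and the two infima\<close>

context
  fixes f :: "complex \<Rightarrow> real"
  assumes bho: "bounded_hyp_oscillation (\<lambda>z. exp (f z))"
begin

text \<open>Measurability of f is contained in the integrability of the weight e^f.\<close>

lemma bho_measurable: "f \<in> borel_measurable disc_area"
proof -
  have "(\<lambda>z. ln (exp (f z))) \<in> borel_measurable disc_area"
    using bho unfolding bounded_hyp_oscillation_def weight_def
    by (intro borel_measurable_ln borel_measurable_integrable) auto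
  then show ?thesis by simp
qed

lemma bhoE:
  obtains C where "0 \<le> C"
    "\<And>z w. norm z < 1 \<Longrightarrow> norm w < 1 \<Longrightarrow> \<bar>f z - f w\<bar> \<le> C * (1 + hyp_dist z w)"
proof -
  obtain C where "0 < C" "\<forall>z\<in>unit_disc. \<forall>w\<in>unit_disc.
      \<bar>ln (exp (f z)) - ln (exp (f w))\<bar> \<le> C * (1 + hyp_dist z w)"
    using bho unfolding bounded_hyp_oscillation_def by blast
  then show thesis by (intro that[of C]) auto
qed

text \<open>If f - h is Lipschitz with constant L, then for every t > L / 2 the function (f - h) / t
  has constant L / t < 2, so t is admissible in the infimum defining
  \<open>gamma_B2\<close>.\<close>

lemma two_gamma_B2_le_HLip_norm:
  assumes h: "h \<in> Linfty_disc"
  shows "2 * gamma_B2 f \<le> HLip_norm (\<lambda>z. f z - h z)"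
proof (cases "HLip_norm (\<lambda>z. f z - h z)")
  case (real L)
  obtain M where M: "AE z in disc_area. \<bar>h z\<bar> \<le> M" using h by (auto simp: Linfty_disc_def)
  have lip: "\<bar>(f z - h z) - (f w - h w)\<bar> \<le> L * hyp_dist z w" if "norm z < 1" "norm w < 1" for z w
    using HLip_norm_leD[of "\<lambda>z. f z - h z" L z w] real that by simp
  have "gamma_B2 f \<le> ennreal t" if t: "L / 2 < t" for t
    unfolding gamma_B2_def
  proof (rule INF_lower, safe)
    show t0: "0 < t" using t real by simp
    show "B2_weight (\<lambda>z. exp (f z / t))"
    proof (rule B2_weight_exp_of_hyp_lipschitz)
      show "(\<lambda>z. f z / t) \<in> borel_measurable disc_area" using bho_measurable by measurable
      show "0 \<le> L / t" "L / t < 2" using t t0 real by (auto simp: field_simps)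
      show "\<bar>(f z - h z) / t - (f w - h w) / t\<bar> \<le> L / t * hyp_dist z w"
        if "norm z < 1" "norm w < 1" for z w
      proof -
        have "\<bar>(f z - h z) / t - (f w - h w) / t\<bar> = \<bar>(f z - h z) - (f w - h w)\<bar> / t"
          using t0 by (simp add: diff_divide_distrib[symmetric])
        then show ?thesis using divide_right_mono[OF lip[OF that], of t] t0 by simp
      qed
      show "AE z in disc_area. \<bar>f z / t - (f z - h z) / t\<bar> \<le> M / t"
        using M by eventually_elim (use t0 in \<open>simp add: diff_divide_distrib divide_right_mono\<close>)
    qed
  qed
  then have "gamma_B2 f \<le> ennreal (L / 2 + e)" if "0 < e" for e using that by simp
  then have "gamma_B2 f \<le> ennreal (L / 2) + ennreal e" if "0 < e" for e
    using that real by (metis divide_nonneg_pos ennreal_plus less_imp_le zero_less_numeral)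
  then have "gamma_B2 f \<le> ennreal (L / 2)"
    by (rule ennreal_le_epsilon)
  then have "2 * gamma_B2 f \<le> ennreal 2 * ennreal (L / 2)" by (intro mult_mono) auto
  also have "\<dots> = ennreal L" using real by (subst ennreal_mult[symmetric]) auto
  finally show ?thesis using real by simp
qed simp

lemma HLip_norm_le_four_gamma_B2:
  "(INF h\<in>Linfty_disc. HLip_norm (\<lambda>z. f z - h z)) \<le> 4 * gamma_B2 f"
proof -
  obtain C where C: "0 \<le> C"
    "\<And>z w. norm z < 1 \<Longrightarrow> norm w < 1 \<Longrightarrow> \<bar>f z - f w\<bar> \<le> C * (1 + hyp_dist z w)" by (rule bhoE) (rule that)
  have "(INF h\<in>Linfty_disc. HLip_norm (\<lambda>z. f z - h z)) \<le> ennreal 4 * gamma_B2 f"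
    unfolding gamma_B2_def
  proof (rule le_ennreal_mult_INF)
    fix t assume "t \<in> {t. 0 < t \<and> B2_weight (\<lambda>z. exp (f z / t))}"
    then have t: "0 < t" "B2_weight (\<lambda>z. exp (f z / t))" by auto
    obtain C' where "\<And>z w. norm z < 1 \<Longrightarrow> norm w < 1 \<Longrightarrow> \<bar>f z - f w\<bar> \<le> 4 * t * hyp_dist z w + C'"
      using B2_weight_imp_quasi_lipschitz[OF t C(2,1)] by blast
    then obtain h where h: "h \<in> Linfty_disc" "HLip_norm (\<lambda>z. f z - h z) \<le> ennreal (4 * t)"
      using quasi_lipschitz_regularization[OF bho_measurable, of "4 * t" C'] t by auto
    from h(2) have "HLip_norm (\<lambda>z. f z - h z) \<le> ennreal 4 * ennreal t"
      using t by (simp add: ennreal_mult)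
    then show "(INF h\<in>Linfty_disc. HLip_norm (\<lambda>z. f z - h z)) \<le> ennreal 4 * ennreal t"
      by (rule INF_lower2[OF h(1)])
  qed simp
  then show ?thesis by simp
qed

text \<open>The comparison holds for each \<open>h\<close> separately and then passes to the
  infima.\<close>

lemma INF_BMO_norm_le_INF_HLip_norm:
  "(INF h\<in>Linfty_disc. BMO_norm (\<lambda>z. f z - h z))
    \<le> ennreal (2 * (6 * box_const (1 / 2) * 64\<^sup>2 + 1)) * (INF h\<in>Linfty_disc. HLip_norm (\<lambda>z. f z - h z))"
proof -
  define K where "K = 2 * (6 * box_const (1 / 2) * 64\<^sup>2 + 1)"
  have K: "0 < K" using box_const_pos[of "1 / 2"] by (simp add: K_def)
  have "BMO_norm (\<lambda>z. f z - h z) \<le> ennreal K * HLip_norm (\<lambda>z. f z - h z)" for h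
  proof (cases "HLip_norm (\<lambda>z. f z - h z)")
    case (real L)
    have "BMO_norm (\<lambda>z. f z - h z) \<le> ennreal (2 * (L * (6 * box_const (1 / 2) * 64\<^sup>2 + 1)))"
      using real HLip_norm_leD[of "\<lambda>z. f z - h z" L]
      by (intro BMO_norm_le_of_hyp_lipschitz) auto
    also have "\<dots> = ennreal K * ennreal L" using K real by (simp add: K_def mult_ac flip: ennreal_mult)
    finally show ?thesis using real by simp
  qed (use K in \<open>simp add: ennreal_mult_top\<close>)
  then show ?thesis
    unfolding K_def[symmetric] by (intro le_ennreal_mult_INF K) (blast intro: INF_lower2)
qed

text \<open>Here \<open>h\<close> has to be exchanged for another bounded function: a finite BMO
  norm of f - h gives only a quasi-Lipschitz estimate for f, and the regularization of f supplies
  the new function.\<close>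

lemma INF_HLip_norm_le_INF_BMO_norm:
  "(INF h\<in>Linfty_disc. HLip_norm (\<lambda>z. f z - h z))
    \<le> ennreal (10 / artanh (1 / 17)) * (INF h\<in>Linfty_disc. BMO_norm (\<lambda>z. f z - h z))"
proof -
  define K :: real where "K = 10 / artanh (1 / 17)"
  have K: "0 < K" by (simp add: K_def artanh_def)
  obtain C where C: "0 \<le> C"
    "\<And>z w. norm z < 1 \<Longrightarrow> norm w < 1 \<Longrightarrow> \<bar>f z - f w\<bar> \<le> C * (1 + hyp_dist z w)" by (rule bhoE) (rule that)
  have "\<exists>h'\<in>Linfty_disc. HLip_norm (\<lambda>z. f z - h' z) \<le> ennreal K * BMO_norm (\<lambda>z. f z - h z)"
    if h: "h \<in> Linfty_disc" for h
  proof (cases "BMO_norm (\<lambda>z. f z - h z)")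
    case (real N)
    obtain C' where C': "\<And>z w. norm z < 1 \<Longrightarrow> norm w < 1 \<Longrightarrow>
        \<bar>f z - f w\<bar> \<le> 10 * N / artanh (1 / 17) * hyp_dist z w + C'"
      using quasi_lipschitz_of_BMO_norm[OF bho_measurable h _ _ C(2,1), of N] real by auto
    have "10 * N / artanh (1 / 17) = K * N" by (simp add: K_def)
    with C' quasi_lipschitz_regularization[OF bho_measurable, of "K * N" C'] K real
    show ?thesis by (auto simp: ennreal_mult)
  qed (use K h in \<open>auto simp: ennreal_mult_top\<close>)
  then show ?thesis
    unfolding K_def[symmetric] by (intro le_ennreal_mult_INF K) (blast intro: INF_lower2)
qed

end

theorem theorem1p1:
  shows "(\<forall>f :: complex \<Rightarrow> real. bounded_hyp_oscillation (\<lambda>z. exp (f z)) \<longrightarrow>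
            2 * gamma_B2 f \<le> (INF h\<in>Linfty_disc. HLip_norm (\<lambda>z. f z - h z)) \<and>
            (INF h\<in>Linfty_disc. HLip_norm (\<lambda>z. f z - h z)) \<le> 4 * gamma_B2 f)
       \<and> (\<exists>C::real. C > 0 \<and>
            (\<forall>f :: complex \<Rightarrow> real. bounded_hyp_oscillation (\<lambda>z. exp (f z)) \<longrightarrow>
               ennreal (inverse C) * gamma_B2 f
                 \<le> (INF h\<in>Linfty_disc. BMO_norm (\<lambda>z. f z - h z)) \<and>
               (INF h\<in>Linfty_disc. BMO_norm (\<lambda>z. f z - h z)) \<le> ennreal C * gamma_B2 f))"
proof (intro conjI allI impI)
  fix f :: "complex \<Rightarrow> real" assume f: "bounded_hyp_oscillation (\<lambda>z. exp (f z))"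
  show "2 * gamma_B2 f \<le> (INF h\<in>Linfty_disc. HLip_norm (\<lambda>z. f z - h z))"
    by (rule INF_greatest) (rule two_gamma_B2_le_HLip_norm[OF f])
  show "(INF h\<in>Linfty_disc. HLip_norm (\<lambda>z. f z - h z)) \<le> 4 * gamma_B2 f"
    by (rule HLip_norm_le_four_gamma_B2[OF f])
next
  define K1 K2 :: real where "K1 = 2 * (6 * box_const (1 / 2) * 64\<^sup>2 + 1)" and "K2 = 10 / artanh (1 / 17)"
  have K: "0 < K1" "0 < K2"
    using box_const_pos[of "1 / 2"] by (simp_all add: K1_def K2_def artanh_def)
  \<comment> \<open>\<open>K2\<close> is needed for the lower bound, and 4 \<open>K1\<close> for the
    upper bound, which passes through the Lipschitz infimum and its estimate by 4
    \<open>gamma_B2 f\<close>.\<close>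
  define C where "C = 4 * K1 + K2"
  have C: "0 < C" "4 * K1 \<le> C" "K2 \<le> C" using K by (simp_all add: C_def)
  have *: "ennreal (inverse C) * gamma_B2 f \<le> (INF h\<in>Linfty_disc. BMO_norm (\<lambda>z. f z - h z)) \<and>
      (INF h\<in>Linfty_disc. BMO_norm (\<lambda>z. f z - h z)) \<le> ennreal C * gamma_B2 f"
    if f: "bounded_hyp_oscillation (\<lambda>z. exp (f z))" for f
  proof
    define H B where "H = (INF h\<in>Linfty_disc. HLip_norm (\<lambda>z. f z - h z))"
      and "B = (INF h\<in>Linfty_disc. BMO_norm (\<lambda>z. f z - h z))"
    have "1 * gamma_B2 f \<le> 2 * gamma_B2 f" by (intro mult_right_mono) auto
    also have "\<dots> \<le> H"
      unfolding H_def by (rule INF_greatest) (rule two_gamma_B2_le_HLip_norm[OF f])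
    also have "\<dots> \<le> ennreal K2 * B"
      unfolding H_def B_def K2_def by (rule INF_HLip_norm_le_INF_BMO_norm[OF f])
    also have "\<dots> \<le> ennreal C * B" using C by (intro mult_right_mono ennreal_leI) auto
    finally have "ennreal (inverse C) * gamma_B2 f \<le> ennreal (inverse C) * (ennreal C * B)"
      by (intro mult_left_mono) auto
    also have "\<dots> = B" using C by (simp add: mult.assoc[symmetric] flip: ennreal_mult)
    finally show "ennreal (inverse C) * gamma_B2 f \<le> (INF h\<in>Linfty_disc. BMO_norm (\<lambda>z. f z - h z))"
      by (simp add: B_def)
    have "B \<le> ennreal K1 * H"
      unfolding H_def B_def K1_def by (rule INF_BMO_norm_le_INF_HLip_norm[OF f])
    also have "\<dots> \<le> ennreal K1 * (4 * gamma_B2 f)"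
      unfolding H_def by (intro mult_left_mono HLip_norm_le_four_gamma_B2[OF f]) auto
    also have "\<dots> = ennreal (4 * K1) * gamma_B2 f"
      using K by (simp add: ennreal_mult mult_ac)
    also have "\<dots> \<le> ennreal C * gamma_B2 f" using C by (intro mult_right_mono ennreal_leI) auto
    finally show "(INF h\<in>Linfty_disc. BMO_norm (\<lambda>z. f z - h z)) \<le> ennreal C * gamma_B2 f"
      by (simp add: B_def)
  qed
  then show "\<exists>C::real. C > 0 \<and>
            (\<forall>f :: complex \<Rightarrow> real. bounded_hyp_oscillation (\<lambda>z. exp (f z)) \<longrightarrow>
               ennreal (inverse C) * gamma_B2 f
                 \<le> (INF h\<in>Linfty_disc. BMO_norm (\<lambda>z. f z - h z)) \<and>
               (INF h\<in>Linfty_disc. BMO_norm (\<lambda>z. f z - h z)) \<le> ennreal C * gamma_B2 f)"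
    using C(1) by blast
qed

end
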